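(* An $\mathbb H^{n\times m}$-valued function $S$ is a contractive multiplier from $\mathfrak A^m$ into $\mathfrak A^n$ if and only if the $\mathbb H^{n\times n}$-valued kernel $$K(x,y)=\sum_{\alpha\in\mathbb N_0^3}\frac{|\alpha|!}{\alpha!}\left\{\mu^\alpha(x)\overline{\mu^\alpha(y)}I_n-\left(\mu^\alpha\star_{V_q}S\right)(x)\left(\left(\mu^\alpha\star_{V_q}S\right)(y)\right)^*\right\}$$ is positive definite in $\Omega_A$.
   Context: $\mathbb H$ denotes the quaternions; for a quaternionic matrix, ${}^*$ is the conjugate transpose. A point $x=(x_0,x_1,x_2,x_3)\in\mathbb R^4$ is identified with $q=x_0+\vec q$, where $\vec q=x_1\mathbf e_1+x_2\mathbf e_2+x_3\mathbf e_3$, and $\mathbb H^*=\{q:\vec q\neq0\}$. For $x\in\mathbb H^*$, $\mu_u(x)=x_u\left(1+\frac{x_0}{\vec q}\right)$, $u=1,2,3$, and $\mu^\alpha=\mu_1^{\alpha_1}\mu_2^{\alpha_2}\mu_3^{\alpha_3}$; $|\alpha|=\alpha_1+\alpha_2+\alpha_3$, $\alpha!=\alpha_1!\alpha_2!\alpha_3!$. $\Omega_A=\{x\in\mathbb H^*:\sum_{\alpha\in\mathbb N_0^3}|\mu^\alpha(x)|^2\frac{|\alpha|!}{\alpha!}<\infty\}$. The Arveson space $\mathfrak A$ is the right quaternionic reproducing kernel Hilbert space of series $f=\sum_\alpha\mu^\alpha f_\alpha$ ($f_\alpha\in\mathbb H$) on $\Omega_A$ with $\langle f,f\rangle=\sum_\alpha\frac{\alpha!}{|\alpha|!}|f_\alpha|^2<\infty$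 and kernel $K_{\mathfrak A}(x,y)=\sum_\alpha\frac{|\alpha|!}{\alpha!}\mu^\alpha(x)\overline{\mu^\alpha(y)}$. The operator $V_q$ is $V_qf=\frac{\partial f}{\partial x_0}-\frac1{\vec q}\sum_{u=1}^3x_u\frac{\partial f}{\partial x_u}$. For a real analytic function $h(x_1,x_2,x_3)$ on an open subset of $\mathbb H^*\cap\{x_0=0\}$, $CK_{V_q}(h)$ is the unique real analytic solution $F$ of $V_qF=0$ with $F|_{x_0=0}=h$; the CK-product is $f\star_{V_q}g=CK_{V_q}\big(f(0,x_1,x_2,x_3)g(0,x_1,x_2,x_3)\big)$ (entrywise for matrix-valued functions of compatible sizes). Here $S$ is a function on $\Omega_A$ which is real analytic with $V_qS=0$, so that these CK-products are defined. $S$ is a contractive multiplier from $\mathfrak A^m$ into $\mathfrak A^n$ if $M_S:f\mapsto S\star_{V_q}f$ maps $\mathfrak A^m$ into $\mathfrak A^n$ (column vectors) with operator norm at most $1$. An $\mathbb H^{n\times n}$-valued kernel $K(x,y)$ is positive definite in $\Omega_A$ if $\sum_{i,j=1}^N\xi_i^*K(x_i,x_j)\xi_j\ge0$ for all $N\in\mathbb N$, $x_1,\dots,x_N\in\Omega_A$ and $\xi_1,\dots,\xi_N\in\mathbb H^n$ (with convergence of the series being part of the condition). *)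

theory Defs
  imports "HOL-Analysis.Analysis"
begin

section \<open>Quaternions\<close>

datatype quat = Quat (qre: real) (qim1: real) (qim2: real) (qim3: real)

lemma quat_eq_iff: "x = y \<longleftrightarrow> qre x = qre y \<and> qim1 x = qim1 y \<and> qim2 x = qim2 y \<and> qim3 x = qim3 y"
  by (auto intro: quat.expand)

instantiation quat :: real_vector
begin

definition zero_quat :: quat where "0 = Quat 0 0 0 0"

definition plus_quat :: "quat \<Rightarrow> quat \<Rightarrow> quat" where
  "x + y = Quat (qre x + qre y) (qim1 x + qim1 y) (qim2 x + qim2 y) (qim3 x + qim3 y)"

definition uminus_quat :: "quat \<Rightarrow> quat" where
  "- x = Quat (- qre x) (- qim1 x) (- qim2 x) (- qim3 x)"

definition minus_quat :: "quat \<Rightarrow> quat \<Rightarrow> quat" where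
  "x - y = Quat (qre x - qre y) (qim1 x - qim1 y) (qim2 x - qim2 y) (qim3 x - qim3 y)"

definition scaleR_quat :: "real \<Rightarrow> quat \<Rightarrow> quat" where
  "r *\<^sub>R x = Quat (r * qre x) (r * qim1 x) (r * qim2 x) (r * qim3 x)"

instance
  by standard
    (simp_all add: quat_eq_iff zero_quat_def plus_quat_def uminus_quat_def minus_quat_def
      scaleR_quat_def algebra_simps)

end

lemma quat_linear_simps [simp]:
  "qre 0 = 0" "qim1 0 = 0" "qim2 0 = 0" "qim3 0 = 0"
  "qre (x + y) = qre x + qre y" "qim1 (x + y) = qim1 x + qim1 y"
  "qim2 (x + y) = qim2 x + qim2 y" "qim3 (x + y) = qim3 x + qim3 y"
  "qre (- x) = - qre x" "qim1 (- x) = - qim1 x" "qim2 (- x) = - qim2 x" "qim3 (- x) = - qim3 x"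
  "qre (x - y) = qre x - qre y" "qim1 (x - y) = qim1 x - qim1 y"
  "qim2 (x - y) = qim2 x - qim2 y" "qim3 (x - y) = qim3 x - qim3 y"
  "qre (r *\<^sub>R x) = r * qre x" "qim1 (r *\<^sub>R x) = r * qim1 x"
  "qim2 (r *\<^sub>R x) = r * qim2 x" "qim3 (r *\<^sub>R x) = r * qim3 x"
  by (simp_all add: zero_quat_def plus_quat_def uminus_quat_def minus_quat_def scaleR_quat_def)

instantiation quat :: real_algebra_1
begin

definition one_quat :: quat where "1 = Quat 1 0 0 0"

definition times_quat :: "quat \<Rightarrow> quat \<Rightarrow> quat" where
  "x * y = Quat
     (qre x * qre y - qim1 x * qim1 y - qim2 x * qim2 y - qim3 x * qim3 y)
     (qre x * qim1 y + qim1 x * qre y + qim2 x * qim3 y - qim3 x * qim2 y)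
     (qre x * qim2 y - qim1 x * qim3 y + qim2 x * qre y + qim3 x * qim1 y)
     (qre x * qim3 y + qim1 x * qim2 y - qim2 x * qim1 y + qim3 x * qre y)"

instance
  by standard (simp_all add: quat_eq_iff one_quat_def times_quat_def algebra_simps)

end

lemma quat_mult_simps [simp]:
  "qre 1 = 1" "qim1 1 = 0" "qim2 1 = 0" "qim3 1 = 0"
  "qre (x * y) = qre x * qre y - qim1 x * qim1 y - qim2 x * qim2 y - qim3 x * qim3 y"
  "qim1 (x * y) = qre x * qim1 y + qim1 x * qre y + qim2 x * qim3 y - qim3 x * qim2 y"
  "qim2 (x * y) = qre x * qim2 y - qim1 x * qim3 y + qim2 x * qre y + qim3 x * qim1 y"
  "qim3 (x * y) = qre x * qim3 y + qim1 x * qim2 y - qim2 x * qim1 y + qim3 x * qre y"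
  by (simp_all add: one_quat_def times_quat_def)

instantiation quat :: real_inner
begin

definition inner_quat :: "quat \<Rightarrow> quat \<Rightarrow> real" where
  "inner_quat x y = qre x * qre y + qim1 x * qim1 y + qim2 x * qim2 y + qim3 x * qim3 y"

definition norm_quat :: "quat \<Rightarrow> real" where "norm_quat x = sqrt (inner x x)"

definition sgn_quat :: "quat \<Rightarrow> quat" where "sgn_quat x = x /\<^sub>R norm x"

definition dist_quat :: "quat \<Rightarrow> quat \<Rightarrow> real" where "dist_quat x y = norm (x - y)"

definition uniformity_quat :: "(quat \<times> quat) filter" where
  "uniformity_quat = (INF e\<in>{0 <..}. principal {(x, y). dist x y < e})"

definition open_quat :: "quat set \<Rightarrow> bool" where
  "open_quat U \<longleftrightarrow> (\<forall>x\<in>U. eventually (\<lambda>(x', y). x' = x \<longrightarrow> y \<in> U) uniformity)"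

instance
proof
  fix x y z :: quat and r :: real and U :: "quat set"
  show "dist x y = norm (x - y)" by (rule dist_quat_def)
  show "sgn x = x /\<^sub>R norm x" by (rule sgn_quat_def)
  show "uniformity = (INF e\<in>{0 <..}. principal {(x :: quat, y). dist x y < e})"
    by (rule uniformity_quat_def)
  show "open U \<longleftrightarrow> (\<forall>x\<in>U. eventually (\<lambda>(x', y). x' = x \<longrightarrow> y \<in> U) uniformity)"
    by (rule open_quat_def)
  show "inner x y = inner y x" by (simp add: inner_quat_def mult.commute)
  show "inner (x + y) z = inner x z + inner y z" by (simp add: inner_quat_def algebra_simps)
  show "inner (r *\<^sub>R x) y = r * inner x y" by (simp add: inner_quat_def algebra_simps)
  show "0 \<le> inner x x" by (simp add: inner_quat_def)
  show "inner x x = 0 \<longleftrightarrow> x = 0"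
    by (simp add: inner_quat_def quat_eq_iff add_nonneg_eq_0_iff)
  show "norm x = sqrt (inner x x)" by (rule norm_quat_def)
qed

end

definition e1 :: quat where "e1 = Quat 0 1 0 0"
definition e2 :: quat where "e2 = Quat 0 0 1 0"
definition e3 :: quat where "e3 = Quat 0 0 0 1"

instantiation quat :: euclidean_space
begin

definition Basis_quat :: "quat set" where "Basis_quat = {1, e1, e2, e3}"

instance
proof
  fix u v x :: quat
  show "(Basis :: quat set) \<noteq> {}" "finite (Basis :: quat set)"
    by (simp_all add: Basis_quat_def)
  show "inner u v = (if u = v then 1 else 0)" if "u \<in> Basis" "v \<in> Basis"
    using that unfolding Basis_quat_def
    by (elim insertE emptyE; hypsubst)
      (simp_all add: inner_quat_def e1_def e2_def e3_def one_quat_def)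
  show "(\<forall>u\<in>Basis. inner x u = 0) \<longleftrightarrow> x = 0"
    by (simp add: Basis_quat_def inner_quat_def e1_def e2_def e3_def, simp add: quat_eq_iff)
qed

end

definition qcnj :: "quat \<Rightarrow> quat" where
  "qcnj x = Quat (qre x) (- qim1 x) (- qim2 x) (- qim3 x)"

lemma quat_norm_square: "(norm x)\<^sup>2 = (qre x)\<^sup>2 + (qim1 x)\<^sup>2 + (qim2 x)\<^sup>2 + (qim3 x)\<^sup>2" for x :: quat
  unfolding power2_norm_eq_inner inner_quat_def by (simp only: power2_eq_square)

lemma quat_mult_cnj:
  "x * qcnj x = (norm x)\<^sup>2 *\<^sub>R 1" "qcnj x * x = (norm x)\<^sup>2 *\<^sub>R 1"
  unfolding quat_norm_square by (simp_all add: quat_eq_iff qcnj_def power2_eq_square)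

instantiation quat :: division_ring
begin

definition inverse_quat :: "quat \<Rightarrow> quat" where "inverse_quat x = qcnj x /\<^sub>R (norm x)\<^sup>2"

definition divide_quat :: "quat \<Rightarrow> quat \<Rightarrow> quat" where "divide_quat x y = x * inverse y"

instance
proof
  fix x y :: quat
  show "inverse (0 :: quat) = 0"
    by (simp add: inverse_quat_def)
  show "x div y = x * inverse y" by (rule divide_quat_def)
  assume "x \<noteq> 0"
  then have n: "(norm x)\<^sup>2 \<noteq> 0" by simp
  show "inverse x * x = 1" "x * inverse x = 1"
    using n by (simp_all only: inverse_quat_def mult_scaleR_left mult_scaleR_right quat_mult_cnj
      scaleR_scaleR left_inverse[OF n] scaleR_one)
qed

end

lemma four_squares:
  fixes a b c d e f g h :: real
  shows "(a * e - b * f - c * g - d * h)\<^sup>2 + (a * f + b * e + c * h - d * g)\<^sup>2 +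
      (a * g - b * h + c * e + d * f)\<^sup>2 + (a * h + b * g - c * f + d * e)\<^sup>2 =
    (a\<^sup>2 + b\<^sup>2 + c\<^sup>2 + d\<^sup>2) * (e\<^sup>2 + f\<^sup>2 + g\<^sup>2 + h\<^sup>2)"
  by algebra

instance quat :: real_normed_div_algebra
proof
  fix x y :: quat
  show "norm (x * y) = norm x * norm y"
  proof (rule power2_eq_imp_eq)
    show "(norm (x * y))\<^sup>2 = (norm x * norm y)\<^sup>2"
      unfolding power_mult_distrib quat_norm_square quat_mult_simps by (rule four_squares)
  qed simp_all
qed


section \<open>Real analytic functions, the operator \<open>V_q\<close> and the CK-product\<close>

text \<open>A point \<open>(x0, x1, x2, x3)\<close> of real 4-space is the quaternion \<open>Quat x0 x1 x2 x3\<close>. Functions on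
  an open set \<open>U\<close> are total functions of which only the values on \<open>U\<close> are used.\<close>

definition qvec :: "quat \<Rightarrow> quat" where
  "qvec x = Quat 0 (qim1 x) (qim2 x) (qim3 x)"

definition real_analytic_on :: "(quat \<Rightarrow> quat) \<Rightarrow> quat set \<Rightarrow> bool" where
  "real_analytic_on f U \<longleftrightarrow>
     (\<forall>a\<in>U. \<exists>c. \<exists>\<rho>>0. ball a \<rho> \<subseteq> U \<and>
        (\<forall>x\<in>ball a \<rho>.
          ((\<lambda>(k0 :: nat, k1 :: nat, k2 :: nat, k3 :: nat).
              (qre (x - a) ^ k0 * qim1 (x - a) ^ k1 * qim2 (x - a) ^ k2 * qim3 (x - a) ^ k3)
                *\<^sub>R c (k0, k1, k2, k3))
            has_sum f x) UNIV))"

definition pderiv_dir :: "quat \<Rightarrow> (quat \<Rightarrow> quat) \<Rightarrow> quat \<Rightarrow> quat" where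
  "pderiv_dir e f x = vector_derivative (\<lambda>t. f (x + t *\<^sub>R e)) (at 0)"

definition Vq :: "(quat \<Rightarrow> quat) \<Rightarrow> quat \<Rightarrow> quat" where
  "Vq f x = pderiv_dir 1 f x -
     inverse (qvec x) *
       (qim1 x *\<^sub>R pderiv_dir e1 f x + qim2 x *\<^sub>R pderiv_dir e2 f x + qim3 x *\<^sub>R pderiv_dir e3 f x)"

definition Vq_regular_on :: "(quat \<Rightarrow> quat) \<Rightarrow> quat set \<Rightarrow> bool" where
  "Vq_regular_on f U \<longleftrightarrow> real_analytic_on f U \<and> (\<forall>x\<in>U. Vq f x = 0)"

text \<open>The solution is sought on the prescribed domain \<open>U\<close>; the value \<open>0\<close> outside \<open>U\<close> is a
  convention that makes the total function unique.\<close>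

definition CK_Vq :: "quat set \<Rightarrow> (real \<Rightarrow> real \<Rightarrow> real \<Rightarrow> quat) \<Rightarrow> quat \<Rightarrow> quat" where
  "CK_Vq U h =
     (THE F. Vq_regular_on F U \<and>
        (\<forall>x1 x2 x3. Quat 0 x1 x2 x3 \<in> U \<longrightarrow> F (Quat 0 x1 x2 x3) = h x1 x2 x3) \<and>
        (\<forall>x. x \<notin> U \<longrightarrow> F x = 0))"

definition CK_matvec ::
    "quat set \<Rightarrow> (quat \<Rightarrow> quat ^ 'm ^ 'n) \<Rightarrow> (quat \<Rightarrow> quat ^ 'm) \<Rightarrow> quat \<Rightarrow> quat ^ 'n" where
  "CK_matvec U S f x =
     (\<chi> i. CK_Vq U (\<lambda>x1 x2 x3. (S (Quat 0 x1 x2 x3) *v f (Quat 0 x1 x2 x3)) $ i) x)"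

definition CK_scalmat ::
    "quat set \<Rightarrow> (quat \<Rightarrow> quat) \<Rightarrow> (quat \<Rightarrow> quat ^ 'm ^ 'n) \<Rightarrow> quat \<Rightarrow> quat ^ 'm ^ 'n" where
  "CK_scalmat U g S x =
     (\<chi> i j. CK_Vq U (\<lambda>x1 x2 x3. g (Quat 0 x1 x2 x3) * S (Quat 0 x1 x2 x3) $ i $ j) x)"


section \<open>The Arveson space\<close>

type_synonym midx = "nat \<times> nat \<times> nat"

definition mu :: "real \<Rightarrow> quat \<Rightarrow> quat" where
  "mu t x = t *\<^sub>R (1 + of_real (qre x) / qvec x)"

fun mu_pow :: "midx \<Rightarrow> quat \<Rightarrow> quat" where
  "mu_pow (a1, a2, a3) x = mu (qim1 x) x ^ a1 * mu (qim2 x) x ^ a2 * mu (qim3 x) x ^ a3"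

text \<open>The multinomial weight \<open>|\<alpha>|! / \<alpha>!\<close>.\<close>

fun multinom :: "midx \<Rightarrow> real" where
  "multinom (a1, a2, a3) = fact (a1 + a2 + a3) / (fact a1 * fact a2 * fact a3)"

definition Omega_A :: "quat set" where
  "Omega_A = {x. qvec x \<noteq> 0 \<and> (\<lambda>\<alpha>. (norm (mu_pow \<alpha> x))\<^sup>2 * multinom \<alpha>) summable_on UNIV}"

definition mu_series :: "(quat \<Rightarrow> quat) \<Rightarrow> (midx \<Rightarrow> quat) \<Rightarrow> bool" where
  "mu_series f c \<longleftrightarrow> (\<forall>x\<in>Omega_A. ((\<lambda>\<alpha>. mu_pow \<alpha> x * c \<alpha>) has_sum f x) UNIV)"

definition arveson :: "(quat \<Rightarrow> quat) set" where
  "arveson = {f. \<exists>c. mu_series f c \<and> (\<lambda>\<alpha>. (norm (c \<alpha>))\<^sup>2 / multinom \<alpha>) summable_on UNIV}"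

text \<open>The coefficients are determined by the values on \<open>Omega_A\<close>: at \<open>x0 = 0\<close> the series is an ordinary
  power series in \<open>(x1, x2, x3)\<close>.\<close>

definition arveson_coeff :: "(quat \<Rightarrow> quat) \<Rightarrow> midx \<Rightarrow> quat" where
  "arveson_coeff f = (THE c. mu_series f c)"

definition arveson_norm :: "(quat \<Rightarrow> quat) \<Rightarrow> real" where
  "arveson_norm f = sqrt (\<Sum>\<^sub>\<infinity>\<alpha>. (norm (arveson_coeff f \<alpha>))\<^sup>2 / multinom \<alpha>)"

definition arveson_vec :: "(quat \<Rightarrow> quat ^ 'n) set" where
  "arveson_vec = {f. \<forall>i. (\<lambda>x. f x $ i) \<in> arveson}"

definition arveson_vec_norm :: "(quat \<Rightarrow> quat ^ 'n) \<Rightarrow> real" where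
  "arveson_vec_norm f = sqrt (\<Sum>i\<in>UNIV. (arveson_norm (\<lambda>x. f x $ i))\<^sup>2)"

definition contractive_multiplier :: "(quat \<Rightarrow> quat ^ 'm ^ 'n) \<Rightarrow> bool" where
  "contractive_multiplier S \<longleftrightarrow>
     (\<forall>f\<in>arveson_vec. CK_matvec Omega_A S f \<in> arveson_vec \<and>
        arveson_vec_norm (CK_matvec Omega_A S f) \<le> arveson_vec_norm f)"


section \<open>Positive definite kernels\<close>

definition ctranspose :: "quat ^ 'm ^ 'n \<Rightarrow> quat ^ 'n ^ 'm" where
  "ctranspose A = (\<chi> i j. qcnj (A $ j $ i))"

definition sesq_form :: "quat ^ 'n \<Rightarrow> quat ^ 'n ^ 'n \<Rightarrow> quat ^ 'n \<Rightarrow> quat" where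
  "sesq_form \<xi> A \<eta> = (\<Sum>a\<in>UNIV. qcnj (\<xi> $ a) * (A *v \<eta>) $ a)"

text \<open>Nonnegativity of the quaternionic double sum means that it is a real number and nonnegative.\<close>

definition positive_definite_kernel ::
    "quat set \<Rightarrow> (quat \<Rightarrow> quat \<Rightarrow> quat ^ 'n ^ 'n) \<Rightarrow> bool" where
  "positive_definite_kernel U K \<longleftrightarrow>
     (\<forall>N (x :: nat \<Rightarrow> quat) (\<xi> :: nat \<Rightarrow> quat ^ 'n). (\<forall>i<N. x i \<in> U) \<longrightarrow>
        (\<Sum>i<N. \<Sum>j<N. sesq_form (\<xi> i) (K (x i) (x j)) (\<xi> j)) \<in> \<real>\<^sub>\<ge>\<^sub>0)"

definition positive_definite_series ::
    "quat set \<Rightarrow> (midx \<Rightarrow> quat \<Rightarrow> quat \<Rightarrow> quat ^ 'n ^ 'n) \<Rightarrow> bool" where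
  "positive_definite_series U k \<longleftrightarrow>
     (\<forall>x\<in>U. \<forall>y\<in>U. (\<lambda>\<alpha>. k \<alpha> x y) summable_on UNIV) \<and>
     positive_definite_kernel U (\<lambda>x y. \<Sum>\<^sub>\<infinity>\<alpha>. k \<alpha> x y)"

end

theory Submission
  imports Defs "HOL-Complex_Analysis.Conformal_Mappings"
begin

text \<open>
  On the half plane spanned by \<open>1\<close> and \<open>I = qvec x / norm (qvec x)\<close> the equation \<open>V\<^sub>q f = 0\<close> is the
  Cauchy-Riemann equation, and \<open>Omega_A\<close> is the unit ball without the real axis, which these half planes cut
  into half discs. Hence CK-extensions are unique. The values of \<open>\<mu>\<^sup>\<alpha>\<close> commute with \<open>I\<close>, so multiplication
  by \<open>\<mu>\<^sup>\<alpha>\<close> from the left preserves solutions: the CK-product of \<open>\<mu>\<^sup>\<alpha>\<close> and \<open>S\<close> is the pointwise product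
  \<open>\<mu>\<^sup>\<alpha> S\<close>, and the CK-product of \<open>S\<close> and \<open>\<Sum>\<^sub>\<alpha> \<mu>\<^sup>\<alpha> f\<^sub>\<alpha>\<close> is \<open>\<Sum>\<^sub>\<alpha> \<mu>\<^sup>\<alpha> S f\<^sub>\<alpha>\<close>.

  Therefore \<open>\<langle>(S \<star> f)(x), \<xi>\<rangle> = \<langle>f, b\<^bsub>x,\<xi>\<^esub>\<rangle>\<close> and \<open>\<langle>g(x), \<xi>\<rangle> = \<langle>g, k\<^bsub>x,\<xi>\<^esub>\<rangle>\<close>, where \<open>b\<^bsub>x,\<xi>\<^esub>\<close> and
  \<open>k\<^bsub>x,\<xi>\<^esub>\<close> have the coefficients \<open>(\<mu>\<^sup>\<alpha>(x) S(x))\<^sup>* \<xi>\<close> and \<open>(\<mu>\<^sup>\<alpha>(x))\<^sup>* \<xi>\<close>, times \<open>|\<alpha>|! / \<alpha>!\<close>. Positivity of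
  the kernel says that \<open>\<parallel>\<Sum> b\<parallel> \<le> \<parallel>\<Sum> k\<parallel>\<close> for all finite sums, that is, that \<open>k\<^bsub>x,\<xi>\<^esub> \<mapsto> b\<^bsub>x,\<xi>\<^esub>\<close> extends
  to a contraction; its adjoint is the multiplier.
\<close>

section \<open>Square-summable families\<close>

definition square_summable :: "('i \<Rightarrow> 'a::real_normed_vector) \<Rightarrow> bool" where
  "square_summable f \<longleftrightarrow> (\<lambda>i. (norm (f i))\<^sup>2) summable_on UNIV"

lemma square_summable_0: "square_summable (\<lambda>_. 0)"
  by (simp add: square_summable_def)

lemma square_summable_add:
  assumes "square_summable f" "square_summable g"
  shows "square_summable (\<lambda>i. f i + g i)"
  unfolding square_summable_def
proof (rule summable_on_comparison_test)
  show "(\<lambda>i. 2 * (norm (f i))\<^sup>2 + 2 * (norm (g i))\<^sup>2) summable_on UNIV"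
    using assms unfolding square_summable_def
    by (intro summable_on_add summable_on_cmult_right)
  show "(norm (f i + g i))\<^sup>2 \<le> 2 * (norm (f i))\<^sup>2 + 2 * (norm (g i))\<^sup>2" for i
  proof -
    have "(norm (f i + g i))\<^sup>2 \<le> (norm (f i) + norm (g i))\<^sup>2"
      by (intro power_mono norm_triangle_ineq) simp
    also have "\<dots> \<le> 2 * (norm (f i))\<^sup>2 + 2 * (norm (g i))\<^sup>2"
      using sum_squares_bound[of "norm (f i)" "norm (g i)"] by (simp add: power2_sum)
    finally show ?thesis .
  qed
qed simp

lemma square_summable_scaleR:
  assumes "square_summable f"
  shows "square_summable (\<lambda>i. r *\<^sub>R f i)"
  using assms unfolding square_summable_def
  by (simp add: power_mult_distrib summable_on_cmult_right)

lemma square_summable_uminus: "square_summable f \<Longrightarrow> square_summable (\<lambda>i. - f i)"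
  by (simp add: square_summable_def)

lemma square_summable_diff:
  "square_summable f \<Longrightarrow> square_summable g \<Longrightarrow> square_summable (\<lambda>i. f i - g i)"
  using square_summable_add[of f "\<lambda>i. - g i"] square_summable_uminus[of g] by simp

lemma norm_mult_summable_on:
  fixes f :: "'i \<Rightarrow> 'a::real_normed_vector" and g :: "'i \<Rightarrow> 'b::real_normed_vector"
  assumes "square_summable f" "square_summable g"
  shows "(\<lambda>i. norm (f i) * norm (g i)) summable_on UNIV"
proof (rule summable_on_comparison_test)
  show "(\<lambda>i. (norm (f i))\<^sup>2 + (norm (g i))\<^sup>2) summable_on UNIV"
    using assms unfolding square_summable_def by (intro summable_on_add)
  show "norm (f i) * norm (g i) \<le> (norm (f i))\<^sup>2 + (norm (g i))\<^sup>2" for i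
  proof -
    have "norm (f i) * norm (g i) \<le> 2 * norm (f i) * norm (g i)"
      by simp
    also have "\<dots> \<le> (norm (f i))\<^sup>2 + (norm (g i))\<^sup>2"
      by (rule sum_squares_bound)
    finally show ?thesis .
  qed
qed simp

lemma inner_summable_on:
  assumes "square_summable f" "square_summable g"
  shows "(\<lambda>i. inner (f i) (g i)) summable_on UNIV"
proof (rule abs_summable_summable, rule Infinite_Sum.abs_summable_on_comparison_test'[OF norm_mult_summable_on[OF assms]])
  show "norm (inner (f i) (g i)) \<le> norm (f i) * norm (g i)" for i
    using Cauchy_Schwarz_ineq2[of "f i" "g i"] by simp
qed

typedef (overloaded) ('i, 'a) ell2 = "{f :: 'i \<Rightarrow> 'a::real_inner. square_summable f}"
  morphisms coord Abs_ell2
  using square_summable_0 by blast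

setup_lifting type_definition_ell2

lemma square_summable_coord [simp]: "square_summable (coord x)"
  using coord by auto

lemma ell2_eqI: "(\<And>i. coord x i = coord y i) \<Longrightarrow> x = y"
  by (simp add: coord_inject[symmetric] fun_eq_iff)

instantiation ell2 :: (type, real_inner) real_vector
begin

lift_definition zero_ell2 :: "('a, 'b) ell2" is "\<lambda>_. 0"
  by (rule square_summable_0)
lift_definition plus_ell2 :: "('a, 'b) ell2 \<Rightarrow> ('a, 'b) ell2 \<Rightarrow> ('a, 'b) ell2" is "\<lambda>f g i. f i + g i"
  by (rule square_summable_add)
lift_definition minus_ell2 :: "('a, 'b) ell2 \<Rightarrow> ('a, 'b) ell2 \<Rightarrow> ('a, 'b) ell2" is "\<lambda>f g i. f i - g i"
  by (rule square_summable_diff)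
lift_definition uminus_ell2 :: "('a, 'b) ell2 \<Rightarrow> ('a, 'b) ell2" is "\<lambda>f i. - f i"
  by (rule square_summable_uminus)
lift_definition scaleR_ell2 :: "real \<Rightarrow> ('a, 'b) ell2 \<Rightarrow> ('a, 'b) ell2" is "\<lambda>r f i. r *\<^sub>R f i"
  by (rule square_summable_scaleR)

instance
  by standard (transfer; simp add: fun_eq_iff algebra_simps)+

end

lemma coord_simps [simp]:
  "coord 0 i = 0" "coord (x + y) i = coord x i + coord y i" "coord (x - y) i = coord x i - coord y i"
  "coord (- x) i = - coord x i" "coord (r *\<^sub>R x) i = r *\<^sub>R coord x i"
  by (transfer; simp)+

lemma coord_sum: "coord (sum f A) i = (\<Sum>a\<in>A. coord (f a) i)"
  by (induction A rule: infinite_finite_induct) auto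

instantiation ell2 :: (type, real_inner) real_inner
begin

definition inner_ell2 :: "('a, 'b) ell2 \<Rightarrow> ('a, 'b) ell2 \<Rightarrow> real" where
  "inner_ell2 x y = (\<Sum>\<^sub>\<infinity>i. inner (coord x i) (coord y i))"

definition norm_ell2 :: "('a, 'b) ell2 \<Rightarrow> real" where "norm_ell2 x = sqrt (inner x x)"

definition sgn_ell2 :: "('a, 'b) ell2 \<Rightarrow> ('a, 'b) ell2" where "sgn_ell2 x = x /\<^sub>R norm x"

definition dist_ell2 :: "('a, 'b) ell2 \<Rightarrow> ('a, 'b) ell2 \<Rightarrow> real" where "dist_ell2 x y = norm (x - y)"

definition uniformity_ell2 :: "(('a, 'b) ell2 \<times> ('a, 'b) ell2) filter" where
  "uniformity_ell2 = (INF e\<in>{0 <..}. principal {(x, y). dist x y < e})"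

definition open_ell2 :: "('a, 'b) ell2 set \<Rightarrow> bool" where
  "open_ell2 U \<longleftrightarrow> (\<forall>x\<in>U. eventually (\<lambda>(x', y). x' = x \<longrightarrow> y \<in> U) uniformity)"

instance
proof
  fix x y z :: "('a, 'b) ell2" and r :: real and U :: "('a, 'b) ell2 set"
  show "dist x y = norm (x - y)" by (rule dist_ell2_def)
  show "sgn x = x /\<^sub>R norm x" by (rule sgn_ell2_def)
  show "uniformity = (INF e\<in>{0 <..}. principal {(x :: ('a, 'b) ell2, y). dist x y < e})"
    by (rule uniformity_ell2_def)
  show "open U \<longleftrightarrow> (\<forall>x\<in>U. eventually (\<lambda>(x', y). x' = x \<longrightarrow> y \<in> U) uniformity)"
    by (rule open_ell2_def)
  show "inner x y = inner y x" by (simp add: inner_ell2_def inner_commute)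
  show "inner (x + y) z = inner x z + inner y z"
    by (simp add: inner_ell2_def inner_add_left infsum_add inner_summable_on)
  show "inner (r *\<^sub>R x) y = r * inner x y"
    by (simp add: inner_ell2_def infsum_cmult_right inner_summable_on)
  show "0 \<le> inner x x" by (simp add: inner_ell2_def infsum_nonneg)
  show "inner x x = 0 \<longleftrightarrow> x = 0"
  proof
    assume "inner x x = 0"
    then have "inner (coord x i) (coord x i) = 0" for i
      using nonneg_infsum_le_0D[of "\<lambda>i. inner (coord x i) (coord x i)" UNIV i]
      by (simp add: inner_ell2_def inner_summable_on)
    then show "x = 0" by (intro ell2_eqI) simp
  qed (simp add: inner_ell2_def)
  show "norm x = sqrt (inner x x)" by (rule norm_ell2_def)
qed

end

lemma norm_ell2_eq: "(norm x)\<^sup>2 = (\<Sum>\<^sub>\<infinity>i. (norm (coord x i))\<^sup>2)"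
  unfolding power2_norm_eq_inner by (simp add: inner_ell2_def)

lemma inner_ell2_has_sum: "((\<lambda>i. inner (coord x i) (coord y i)) has_sum inner x y) UNIV"
  unfolding inner_ell2_def by (intro has_sum_infsum inner_summable_on) simp_all

lemma sum_norm_coord_le:
  assumes "finite F"
  shows "(\<Sum>i\<in>F. (norm (coord x i))\<^sup>2) \<le> (norm x)\<^sup>2"
  unfolding norm_ell2_eq
  by (intro finite_sum_le_infsum) (use assms square_summable_coord[of x] in \<open>auto simp: square_summable_def\<close>)

lemma norm_coord_le: "norm (coord x i) \<le> norm x"
  by (rule power2_le_imp_le) (use sum_norm_coord_le[of "{i}" x] in simp_all)

instance ell2 :: (type, "{real_inner, complete_space}") complete_space
proof
  fix X :: "nat \<Rightarrow> ('a, 'b) ell2"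
  assume X: "Cauchy X"
  have "convergent (\<lambda>n. coord (X n) i)" for i
  proof (rule Cauchy_convergent, rule CauchyI)
    fix e :: real
    assume "0 < e"
    with X obtain M where "\<forall>m\<ge>M. \<forall>n\<ge>M. norm (X m - X n) < e"
      by (auto simp: Cauchy_iff)
    then show "\<exists>M. \<forall>m\<ge>M. \<forall>n\<ge>M. norm (coord (X m) i - coord (X n) i) < e"
      by (metis coord_simps(3) norm_coord_le order_le_less_trans)
  qed
  then obtain g where g: "(\<lambda>n. coord (X n) i) \<longlonglongrightarrow> g i" for i
    unfolding convergent_def by metis
  have fin: "(\<Sum>i\<in>F. (norm (coord (X n) i - g i))\<^sup>2) \<le> e\<^sup>2"
    if "finite F" and n: "n \<ge> M" and M: "\<forall>m\<ge>M. \<forall>n\<ge>M. norm (X m - X n) < e" for F n M e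
  proof (rule tendsto_le[OF trivial_limit_sequentially tendsto_const])
    show "(\<lambda>m. \<Sum>i\<in>F. (norm (coord (X n) i - coord (X m) i))\<^sup>2) \<longlonglongrightarrow>
        (\<Sum>i\<in>F. (norm (coord (X n) i - g i))\<^sup>2)"
      by (intro tendsto_intros g)
    show "\<forall>\<^sub>F m in sequentially. (\<Sum>i\<in>F. (norm (coord (X n) i - coord (X m) i))\<^sup>2) \<le> e\<^sup>2"
    proof (rule eventually_sequentiallyI[of M])
      fix m assume "M \<le> m"
      have "(\<Sum>i\<in>F. (norm (coord (X n) i - coord (X m) i))\<^sup>2) \<le> (norm (X n - X m))\<^sup>2"
        using sum_norm_coord_le[OF \<open>finite F\<close>, of "X n - X m"] by simp
      also have "\<dots> \<le> e\<^sup>2"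
        using M n \<open>M \<le> m\<close> by (intro power_mono) (auto intro: less_imp_le)
      finally show "(\<Sum>i\<in>F. (norm (coord (X n) i - coord (X m) i))\<^sup>2) \<le> e\<^sup>2" .
    qed
  qed
  have diff: "square_summable (\<lambda>i. coord (X n) i - g i) \<and>
      (\<Sum>\<^sub>\<infinity>i. (norm (coord (X n) i - g i))\<^sup>2) \<le> e\<^sup>2"
    if "n \<ge> M" "\<forall>m\<ge>M. \<forall>n\<ge>M. norm (X m - X n) < e" for n M e
  proof
    show *: "square_summable (\<lambda>i. coord (X n) i - g i)"
      unfolding square_summable_def
      by (rule nonneg_bdd_above_summable_on) (use fin[OF _ that] in \<open>auto intro!: bdd_aboveI2[where M="e\<^sup>2"]\<close>)
    show "(\<Sum>\<^sub>\<infinity>i. (norm (coord (X n) i - g i))\<^sup>2) \<le> e\<^sup>2"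
      using * fin[OF _ that] by (intro infsum_le_finite_sums) (auto simp: square_summable_def)
  qed
  obtain M where M: "\<forall>m\<ge>M. \<forall>n\<ge>M. norm (X m - X n) < 1"
    using X zero_less_one unfolding Cauchy_iff by blast
  have "square_summable (\<lambda>i. coord (X M) i - (coord (X M) i - g i))"
    by (rule square_summable_diff[OF square_summable_coord conjunct1[OF diff[OF order_refl M]]])
  then have "square_summable g"
    by simp
  then have G: "coord (Abs_ell2 g) = g"
    by (simp add: Abs_ell2_inverse)
  have "X \<longlonglongrightarrow> Abs_ell2 g"
  proof (rule LIMSEQ_I)
    fix e :: real
    assume "0 < e"
    with X obtain M where M: "\<forall>m\<ge>M. \<forall>n\<ge>M. norm (X m - X n) < e / 2"
      unfolding Cauchy_iff by (meson half_gt_zero)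
    have "norm (X n - Abs_ell2 g) < e" if "n \<ge> M" for n
    proof -
      have "(norm (X n - Abs_ell2 g))\<^sup>2 \<le> (e / 2)\<^sup>2"
        using diff[OF that M] unfolding norm_ell2_eq by (simp add: G)
      then have "norm (X n - Abs_ell2 g) \<le> e / 2"
        by (rule power2_le_imp_le) (use \<open>0 < e\<close> in simp)
      then show ?thesis
        using \<open>0 < e\<close> by simp
    qed
    then show "\<exists>no. \<forall>n\<ge>no. norm (X n - Abs_ell2 g) < e"
      by blast
  qed
  then show "convergent X"
    by (auto simp: convergent_def)
qed

lemma quadratic_nonneg_imp_linear_coeff_0:
  fixes A B :: real
  assumes "\<And>t. 0 \<le> A * t\<^sup>2 + 2 * B * t"
  shows "B = 0"
proof (rule ccontr)
  assume "B \<noteq> 0"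
  define k where "k = \<bar>A\<bar> + 1"
  have k: "k > 0" "A \<le> k" "A < k" by (auto simp: k_def)
  have "0 \<le> A * (- B / k)\<^sup>2 + 2 * B * (- B / k)"
    by (rule assms)
  also have "\<dots> = (B\<^sup>2 / k) * (A / k - 2)"
    using k by (simp add: field_simps power2_eq_square)
  finally have "0 \<le> (B\<^sup>2 / k) * (A / k - 2)" .
  moreover have "0 < B\<^sup>2 / k"
    using k \<open>B \<noteq> 0\<close> by simp
  ultimately have "0 \<le> A / k - 2"
    by (meson mult_pos_neg not_le)
  moreover have "A / k < 1"
    using k by simp
  ultimately show False
    by simp
qed

text \<open>The vector \<open>g\<close> is the limit of \<open>fst w\<close> along a sequence in \<open>W\<close> minimising
  \<open>\<parallel>fst w\<parallel>\<^sup>2 - 2 \<langle>f, snd w\<rangle>\<close>.\<close>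

lemma contraction_adjoint:
  fixes W :: "('a::{real_inner, complete_space} \<times> 'b::real_inner) set" and f :: 'b
  assumes W: "subspace W" and contr: "\<And>w. w \<in> W \<Longrightarrow> norm (snd w) \<le> norm (fst w)"
  obtains g where "norm g \<le> norm f" "\<forall>w\<in>W. inner g (fst w) = inner f (snd w)"
proof -
  define \<phi> where "\<phi> w = (norm (fst w))\<^sup>2 - 2 * inner f (snd w)" for w :: "'a \<times> 'b"
  have lin: "inner f (snd w) \<le> norm f * norm (fst w)" if "w \<in> W" for w
    using norm_cauchy_schwarz[of f "snd w"] contr[OF that] mult_left_mono[of _ _ "norm f"] by fastforce
  have lower: "- (norm f)\<^sup>2 \<le> \<phi> w" if "w \<in> W" for w
  proof -
    have "0 \<le> (norm (fst w) - norm f)\<^sup>2" by simp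
    then show ?thesis
      using lin[OF that] by (simp add: \<phi>_def power2_diff algebra_simps)
  qed
  have "W \<noteq> {}" using subspace_0[OF W] by auto
  have bdd: "bdd_below (\<phi> ` W)" using lower by (intro bdd_belowI2)
  define m where "m = Inf (\<phi> ` W)"
  have m_le: "m \<le> \<phi> w" if "w \<in> W" for w
    unfolding m_def using bdd that by (rule cINF_lower)
  have "\<exists>w\<in>W. \<phi> w < m + 1 / real (Suc n)" for n
    using cINF_less_iff[OF \<open>W \<noteq> {}\<close> bdd, of "m + 1 / real (Suc n)"] by (simp add: m_def)
  then obtain v where v: "v n \<in> W" "\<phi> (v n) < m + 1 / real (Suc n)" for n
    by metis
  have \<phi>_lim: "(\<lambda>n. \<phi> (v n)) \<longlonglongrightarrow> m"
  proof (rule tendsto_sandwich[OF _ _ tendsto_const])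
    show "(\<lambda>n. m + 1 / real (Suc n)) \<longlonglongrightarrow> m"
      using tendsto_add[OF tendsto_const[of m] LIMSEQ_Suc[OF lim_1_over_n]] by simp
    show "\<forall>\<^sub>F n in sequentially. \<phi> (v n) \<le> m + 1 / real (Suc n)"
      using v(2) by (intro always_eventually) (auto intro: less_imp_le)
  qed (use v m_le in simp)
  have par: "(norm (fst u - fst w))\<^sup>2 \<le> 2 * (\<phi> u + \<phi> w - 2 * m)" if "u \<in> W" "w \<in> W" for u w
  proof -
    have "m \<le> \<phi> ((1 / 2) *\<^sub>R (u + w))"
      by (intro m_le subspace_scale subspace_add W that)
    also have "\<phi> ((1 / 2) *\<^sub>R (u + w)) = (norm (fst u + fst w))\<^sup>2 / 4 - inner f (snd u + snd w)"
      by (simp add: \<phi>_def power_mult_distrib power2_eq_square)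
    finally have "4 * m \<le> (norm (fst u + fst w))\<^sup>2 - 4 * inner f (snd u + snd w)"
      by simp
    then show ?thesis
      by (simp add: \<phi>_def power2_norm_eq_inner inner_diff inner_add inner_commute algebra_simps)
  qed
  have "Cauchy (\<lambda>n. fst (v n))"
  proof (rule CauchyI)
    fix e :: real
    assume "0 < e"
    then have "0 < e\<^sup>2 / 4" by simp
    then obtain N where N: "\<And>n. n \<ge> N \<Longrightarrow> \<phi> (v n) < m + e\<^sup>2 / 4"
      using order_tendstoD(2)[OF \<phi>_lim, of "m + e\<^sup>2 / 4"] by (auto simp: eventually_sequentially)
    have "norm (fst (v k) - fst (v n)) < e" if "k \<ge> N" "n \<ge> N" for k n
    proof (rule power2_less_imp_less)
      have "(norm (fst (v k) - fst (v n)))\<^sup>2 \<le> 2 * (\<phi> (v k) + \<phi> (v n) - 2 * m)"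
        by (intro par v)
      also have "\<dots> < e\<^sup>2"
        using N[OF that(1)] N[OF that(2)] by simp
      finally show "(norm (fst (v k) - fst (v n)))\<^sup>2 < e\<^sup>2" .
    qed (use \<open>0 < e\<close> in simp)
    then show "\<exists>M. \<forall>m\<ge>M. \<forall>n\<ge>M. norm (fst (v m) - fst (v n)) < e"
      by blast
  qed
  then obtain g where g: "(\<lambda>n. fst (v n)) \<longlonglongrightarrow> g"
    using Cauchy_convergent_iff convergent_def by blast
  have eq: "inner g (fst w) = inner f (snd w)" if "w \<in> W" for w
  proof -
    have "0 \<le> (norm (fst w))\<^sup>2 * t\<^sup>2 + 2 * (inner g (fst w) - inner f (snd w)) * t" for t :: real
    proof -
      define q where "q h = (norm (fst w))\<^sup>2 * t\<^sup>2 + 2 * (inner h (fst w) - inner f (snd w)) * t" for h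
      have "(\<lambda>n. \<phi> (v n) + q (fst (v n))) \<longlonglongrightarrow> m + q g"
        unfolding q_def by (intro tendsto_intros \<phi>_lim g)
      moreover have "m \<le> \<phi> (v n) + q (fst (v n))" for n
      proof -
        have "m \<le> \<phi> (v n + t *\<^sub>R w)"
          by (intro m_le subspace_add subspace_scale W v that)
        also have "\<dots> = \<phi> (v n) + q (fst (v n))"
          unfolding \<phi>_def q_def power2_norm_eq_inner
          by (simp add: inner_add inner_commute[of "fst w" "fst (v n)"] power2_eq_square algebra_simps)
        finally show ?thesis .
      qed
      ultimately have "m \<le> m + q g"
        by (intro LIMSEQ_le_const[of _ _ m]) auto
      then show ?thesis
        by (simp add: q_def)
    qed
    from quadratic_nonneg_imp_linear_coeff_0[OF this] show ?thesis
      by simp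
  qed
  have "norm g * norm g \<le> norm f * norm g"
  proof (rule tendsto_le[OF trivial_limit_sequentially])
    show "(\<lambda>n. inner g (fst (v n))) \<longlonglongrightarrow> norm g * norm g"
      using tendsto_inner[OF tendsto_const g, of g]
      by (simp add: power2_norm_eq_inner[symmetric] power2_eq_square)
    show "(\<lambda>n. norm f * norm (fst (v n))) \<longlonglongrightarrow> norm f * norm g"
      by (intro tendsto_intros g)
    show "\<forall>\<^sub>F n in sequentially. inner g (fst (v n)) \<le> norm f * norm (fst (v n))"
      using lin[OF v(1)] unfolding eq[OF v(1)] by (intro always_eventually allI)
  qed
  then have "norm g \<le> norm f"
    by (cases "norm g = 0") (auto simp: mult_le_cancel_right)
  then show ?thesis
    using eq by (auto intro: that)
qed

section \<open>Power series in four real variables\<close>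

lemma has_sum_sum:
  fixes f :: "'i \<Rightarrow> 'k \<Rightarrow> 'a::topological_comm_monoid_add"
  assumes "finite I" "\<And>i. i \<in> I \<Longrightarrow> (f i has_sum S i) A"
  shows "((\<lambda>x. \<Sum>i\<in>I. f i x) has_sum (\<Sum>i\<in>I. S i)) A"
  using assms by (induction I rule: finite_induct) (auto intro: has_sum_add)

lemma summable_on_imp_abs_summable_on_euclidean:
  fixes f :: "'k \<Rightarrow> 'a::euclidean_space"
  assumes "f summable_on A"
  shows "(\<lambda>k. norm (f k)) summable_on A"
proof (rule summable_on_comparison_test)
  have "(\<lambda>k. \<bar>inner (f k) b\<bar>) summable_on A" for b
    using summable_on_iff_abs_summable_on_real[THEN iffD1,
        OF summable_on_bounded_linear[OF bounded_linear_inner_left assms]]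
    by simp
  then have "((\<lambda>k. \<Sum>b\<in>Basis. \<bar>inner (f k) b\<bar>) has_sum (\<Sum>b\<in>Basis. \<Sum>\<^sub>\<infinity>k\<in>A. \<bar>inner (f k) b\<bar>)) A"
    by (intro has_sum_sum has_sum_infsum) auto
  then show "(\<lambda>k. \<Sum>b\<in>Basis. \<bar>inner (f k) b\<bar>) summable_on A"
    by (rule has_sum_imp_summable)
qed (auto intro: norm_le_l1)

type_synonym exp4 = "nat \<times> nat \<times> nat \<times> nat"

fun monom4 :: "exp4 \<Rightarrow> quat \<Rightarrow> real" where
  "monom4 (k0, k1, k2, k3) h = qre h ^ k0 * qim1 h ^ k1 * qim2 h ^ k2 * qim3 h ^ k3"

fun deg4 :: "exp4 \<Rightarrow> nat" where
  "deg4 (k0, k1, k2, k3) = k0 + k1 + k2 + k3"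

lemma monom4_add: "monom4 (k + l) h = monom4 k h * monom4 l h"
  by (cases k; cases l) (simp add: power_add)

lemma deg4_add: "deg4 (k + l) = deg4 k + deg4 l"
  by (cases k; cases l) simp

lemma monom4_0 [simp]: "monom4 0 h = 1" "deg4 0 = 0"
  by (simp_all add: zero_prod_def)

lemma abs_quat_parts_le_norm:
  "\<bar>qre h\<bar> \<le> norm h" "\<bar>qim1 h\<bar> \<le> norm h" "\<bar>qim2 h\<bar> \<le> norm h" "\<bar>qim3 h\<bar> \<le> norm h"
  using zero_le_power2[of "qre h"] zero_le_power2[of "qim1 h"] zero_le_power2[of "qim2 h"]
    zero_le_power2[of "qim3 h"]
  by (rule_tac [!] power2_le_imp_le, simp_all add: quat_norm_square)

lemma abs_monom4_le: "\<bar>monom4 k h\<bar> \<le> norm h ^ deg4 k"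
proof (cases k)
  case (fields k0 k1 k2 k3)
  show ?thesis
    unfolding fields monom4.simps deg4.simps power_add abs_mult power_abs
    by (intro mult_mono power_mono abs_quat_parts_le_norm) auto
qed

lemma monom4_scaleR_eq_case_prod:
  "(\<lambda>k. monom4 k h *\<^sub>R c k) =
    (\<lambda>(k0, k1, k2, k3). (qre h ^ k0 * qim1 h ^ k1 * qim2 h ^ k2 * qim3 h ^ k3) *\<^sub>R c (k0, k1, k2, k3))"
  by auto

definition power_series :: "quat \<Rightarrow> real \<Rightarrow> (exp4 \<Rightarrow> quat) \<Rightarrow> (quat \<Rightarrow> quat) \<Rightarrow> bool" where
  "power_series a s c f \<longleftrightarrow> 0 < s \<and> (\<lambda>k. norm (c k) * s ^ deg4 k) summable_on UNIV \<and>
     (\<forall>x. norm (x - a) < s \<longrightarrow> ((\<lambda>k. monom4 k (x - a) *\<^sub>R c k) has_sum f x) UNIV)"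

definition majorant :: "real \<Rightarrow> (exp4 \<Rightarrow> quat) \<Rightarrow> real" where
  "majorant s c = (\<Sum>\<^sub>\<infinity>k. norm (c k) * s ^ deg4 k)"

lemma norm_monom4_scaleR_le:
  assumes "norm h \<le> s"
  shows "norm (monom4 k h *\<^sub>R c) \<le> norm c * s ^ deg4 k"
proof -
  have "\<bar>monom4 k h\<bar> \<le> s ^ deg4 k"
    by (rule order_trans[OF abs_monom4_le power_mono[OF assms norm_ge_zero]])
  then show ?thesis
    using mult_right_mono[of "\<bar>monom4 k h\<bar>" "s ^ deg4 k" "norm c"] by (simp add: mult.commute)
qed

lemma majorant_has_sum:
  "power_series a s c f \<Longrightarrow> ((\<lambda>k. norm (c k) * s ^ deg4 k) has_sum majorant s c) UNIV"
  by (simp add: power_series_def majorant_def)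

lemma norm_le_majorant: "power_series a s c f \<Longrightarrow> norm (x - a) < s \<Longrightarrow> norm (f x) \<le> majorant s c"
  by (rule norm_infsum_le[OF _ majorant_has_sum])
    (auto simp: power_series_def intro: norm_monom4_scaleR_le)

lemma power_series_cong:
  "power_series a s c f \<Longrightarrow> (\<And>x. norm (x - a) < s \<Longrightarrow> f x = g x) \<Longrightarrow> power_series a s c g"
  by (simp add: power_series_def)

lemma power_series_mono:
  assumes "power_series a s c f" "0 < t" "t \<le> s"
  shows "power_series a t c f"
proof -
  have "(\<lambda>k. norm (c k) * t ^ deg4 k) summable_on UNIV"
    by (rule summable_on_comparison_test[of "\<lambda>k. norm (c k) * s ^ deg4 k"])
      (use assms in \<open>auto simp: power_series_def intro!: mult_left_mono power_mono\<close>)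
  with assms show ?thesis
    by (auto simp: power_series_def)
qed

lemma power_series_finite:
  assumes "0 < s" "finite B" "\<And>k. k \<notin> B \<Longrightarrow> c k = 0"
  shows "power_series a s c (\<lambda>x. \<Sum>k\<in>B. monom4 k (x - a) *\<^sub>R c k)"
    and "majorant s c = (\<Sum>k\<in>B. norm (c k) * s ^ deg4 k)"
proof -
  have *: "((\<lambda>k. norm (c k) * s ^ deg4 k) has_sum (\<Sum>k\<in>B. norm (c k) * s ^ deg4 k)) UNIV"
    by (rule has_sum_finite_neutralI[OF assms(2)]) (use assms in auto)
  then show "majorant s c = (\<Sum>k\<in>B. norm (c k) * s ^ deg4 k)"
    unfolding majorant_def by (rule infsumI)
  have "((\<lambda>k. monom4 k (x - a) *\<^sub>R c k) has_sum (\<Sum>k\<in>B. monom4 k (x - a) *\<^sub>R c k)) UNIV" for x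
    by (rule has_sum_finite_neutralI[OF assms(2)]) (use assms in auto)
  with * show "power_series a s c (\<lambda>x. \<Sum>k\<in>B. monom4 k (x - a) *\<^sub>R c k)"
    using assms(1) by (auto simp: power_series_def intro: has_sum_imp_summable)
qed

lemma power_series_center: "power_series a s c f \<Longrightarrow> f a = c 0"
proof -
  assume "power_series a s c f"
  then have "((\<lambda>k. monom4 k 0 *\<^sub>R c k) has_sum f a) UNIV"
    unfolding power_series_def by (metis diff_self norm_zero)
  moreover have "((\<lambda>k. monom4 k 0 *\<^sub>R c k) has_sum (\<Sum>k\<in>{0}. monom4 k 0 *\<^sub>R c k)) UNIV"
  proof (rule has_sum_finite_neutralI[where B="{0}"])
    fix k :: exp4 assume "k \<in> UNIV - {0}"
    then show "monom4 k 0 *\<^sub>R c k = 0"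
      by (cases k) (auto simp: zero_prod_def power_0_left)
  qed auto
  ultimately show "f a = c 0"
    by (auto dest: has_sum_unique)
qed

lemma power_series_linear:
  assumes "bounded_linear L" "power_series a s c f"
  shows "power_series a s (\<lambda>k. L (c k)) (\<lambda>x. L (f x))"
proof -
  interpret bounded_linear L by fact
  obtain K where K: "\<And>x. norm (L x) \<le> norm x * K"
    using bounded by blast
  have "(\<lambda>k. norm (L (c k)) * s ^ deg4 k) summable_on UNIV"
  proof (rule summable_on_comparison_test)
    show "(\<lambda>k. K * (norm (c k) * s ^ deg4 k)) summable_on UNIV"
      using assms(2) by (intro summable_on_cmult_right) (simp add: power_series_def)
    show "norm (L (c k)) * s ^ deg4 k \<le> K * (norm (c k) * s ^ deg4 k)" for k
      using mult_right_mono[OF K, of "s ^ deg4 k" "c k"] assms(2)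
      by (simp add: power_series_def mult_ac)
  qed (use assms(2) in \<open>simp add: power_series_def\<close>)
  then show ?thesis
    using assms(2) has_sum_bounded_linear[OF assms(1)] by (auto simp: power_series_def scaleR[symmetric])
qed

lemma power_series_infsum:
  fixes c :: "'i \<Rightarrow> exp4 \<Rightarrow> quat"
  assumes "0 < s" and ps: "\<And>i. power_series a s (c i) (f i)"
    and M: "(\<lambda>i. majorant s (c i)) summable_on UNIV"
  shows "power_series a s (\<lambda>k. \<Sum>\<^sub>\<infinity>i. c i k) (\<lambda>x. \<Sum>\<^sub>\<infinity>i. f i x)"
    and "majorant s (\<lambda>k. \<Sum>\<^sub>\<infinity>i. c i k) \<le> (\<Sum>\<^sub>\<infinity>i. majorant s (c i))"
    and "\<And>k. (\<lambda>i. c i k) summable_on UNIV"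
proof -
  have N: "(\<lambda>(i, k). norm (c i k) * s ^ deg4 k) summable_on (UNIV \<times> UNIV)"
  proof (rule summable_on_SigmaI[OF _ M])
    show "((\<lambda>y. case (x, y) of (i, k) \<Rightarrow> norm (c i k) * s ^ deg4 k) has_sum majorant s (c x)) UNIV" for x
      using majorant_has_sum[OF ps] by simp
  qed (use \<open>0 < s\<close> in auto)
  have N': "(\<lambda>(k, i). norm (c i k) * s ^ deg4 k) summable_on (UNIV \<times> UNIV)"
    using summable_on_swap[THEN iffD1, OF N] by (simp add: case_prod_unfold)
  have A: "(\<lambda>i. norm (c i k)) summable_on UNIV" for k
  proof -
    have "(\<lambda>i. norm (c i k) * s ^ deg4 k) summable_on UNIV"
      using summable_on_SigmaD1[OF N', of k] by simp
    then have "(\<lambda>i. norm (c i k) * s ^ deg4 k * inverse (s ^ deg4 k)) summable_on UNIV"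
      by (rule summable_on_cmult_left)
    then show ?thesis
      using \<open>0 < s\<close> by (simp add: field_simps)
  qed
  show A': "(\<lambda>i. c i k) summable_on UNIV" for k
    using A by (rule abs_summable_summable)
  have g: "(\<lambda>k. \<Sum>\<^sub>\<infinity>i. norm (c i k) * s ^ deg4 k) summable_on UNIV"
    using summable_on_Sigma_banach[OF N'] by simp
  have le: "norm (\<Sum>\<^sub>\<infinity>i. c i k) * s ^ deg4 k \<le> (\<Sum>\<^sub>\<infinity>i. norm (c i k) * s ^ deg4 k)" for k
    using norm_infsum_bound[OF A, of k] \<open>0 < s\<close> A
    by (simp add: infsum_cmult_left mult_right_mono)
  have S: "(\<lambda>k. norm (\<Sum>\<^sub>\<infinity>i. c i k) * s ^ deg4 k) summable_on UNIV"
    by (rule summable_on_comparison_test[OF g le]) (use \<open>0 < s\<close> in simp)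
  have "majorant s (\<lambda>k. \<Sum>\<^sub>\<infinity>i. c i k) \<le> (\<Sum>\<^sub>\<infinity>k. \<Sum>\<^sub>\<infinity>i. norm (c i k) * s ^ deg4 k)"
    unfolding majorant_def by (rule infsum_mono[OF S g le])
  also have "\<dots> = (\<Sum>\<^sub>\<infinity>i. majorant s (c i))"
    unfolding majorant_def by (rule infsum_swap_banach[OF N'])
  finally show "majorant s (\<lambda>k. \<Sum>\<^sub>\<infinity>i. c i k) \<le> (\<Sum>\<^sub>\<infinity>i. majorant s (c i))" .
  have "((\<lambda>k. monom4 k (x - a) *\<^sub>R (\<Sum>\<^sub>\<infinity>i. c i k)) has_sum (\<Sum>\<^sub>\<infinity>i. f i x)) UNIV"
    if x: "norm (x - a) < s" for x
  proof -
    let ?T = "\<lambda>(i, k). monom4 k (x - a) *\<^sub>R c i k"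
    have "?T summable_on (UNIV \<times> UNIV)"
    proof (rule abs_summable_summable, rule Infinite_Sum.abs_summable_on_comparison_test'[OF N])
      show "norm (?T p) \<le> (case p of (i, k) \<Rightarrow> norm (c i k) * s ^ deg4 k)" for p
        using norm_monom4_scaleR_le[of "x - a" s "snd p" "c (fst p) (snd p)"] x
        by (simp add: case_prod_unfold)
    qed
    then have T: "(?T has_sum infsum ?T (UNIV \<times> UNIV)) (UNIV \<times> UNIV)"
      by simp
    have "((\<lambda>i. f i x) has_sum infsum ?T (UNIV \<times> UNIV)) UNIV"
      by (rule has_sum_SigmaD[OF T]) (use ps x in \<open>simp add: power_series_def\<close>)
    then have F: "(\<Sum>\<^sub>\<infinity>i. f i x) = infsum ?T (UNIV \<times> UNIV)"
      by (rule infsumI)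
    have T': "((\<lambda>(k, i). monom4 k (x - a) *\<^sub>R c i k) has_sum infsum ?T (UNIV \<times> UNIV)) (UNIV \<times> UNIV)"
      using has_sum_swap[THEN iffD1, OF T] by (simp add: case_prod_unfold)
    show ?thesis
      unfolding F
      by (rule has_sum_SigmaD[OF T']) (use A' in \<open>auto intro!: has_sum_scaleR has_sum_infsum\<close>)
  qed
  with S \<open>0 < s\<close> show "power_series a s (\<lambda>k. \<Sum>\<^sub>\<infinity>i. c i k) (\<lambda>x. \<Sum>\<^sub>\<infinity>i. f i x)"
    by (simp add: power_series_def)
qed

text \<open>The functions with \<open>majorized a s M f\<close> for some \<open>M\<close> form a Banach algebra whose norm is the
  smallest such \<open>M\<close>; as the radius \<open>s\<close> shrinks to \<open>0\<close>, this norm decreases to \<open>norm (f a)\<close>.\<close>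

definition majorized :: "quat \<Rightarrow> real \<Rightarrow> real \<Rightarrow> (quat \<Rightarrow> quat) \<Rightarrow> bool" where
  "majorized a s M f \<longleftrightarrow> (\<exists>c. power_series a s c f \<and> majorant s c \<le> M)"

lemma majorizedD:
  assumes "majorized a s M f"
  shows "0 < s" "0 \<le> M" "norm (x - a) < s \<Longrightarrow> norm (f x) \<le> M"
proof -
  obtain c where c: "power_series a s c f" "majorant s c \<le> M"
    using assms by (auto simp: majorized_def)
  show "0 < s" using c by (simp add: power_series_def)
  show *: "norm (x - a) < s \<Longrightarrow> norm (f x) \<le> M" for x
    using norm_le_majorant[OF c(1)] c(2) by fastforce
  show "0 \<le> M"
    using order_trans[OF norm_ge_zero *[of a]] \<open>0 < s\<close> by simp
qed

lemma majorized_cong: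
  "majorized a s M f \<Longrightarrow> (\<And>x. norm (x - a) < s \<Longrightarrow> f x = g x) \<Longrightarrow> majorized a s M g"
  by (auto simp: majorized_def intro: power_series_cong)

lemma majorized_const: "0 < s \<Longrightarrow> majorized a s (norm v) (\<lambda>_. v)"
  unfolding majorized_def
  using power_series_finite[of s "{0}" "\<lambda>k. if k = 0 then v else 0"]
  by (intro exI[of _ "\<lambda>k. if k = 0 then v else 0"]) simp

lemma majorized_add:
  assumes "majorized a s M f" "majorized a s N g"
  shows "majorized a s (M + N) (\<lambda>x. f x + g x)"
proof -
  obtain c d where c: "power_series a s c f" "majorant s c \<le> M"
    and d: "power_series a s d g" "majorant s d \<le> N"
    using assms by (auto simp: majorized_def)
  have le: "norm (c k + d k) * s ^ deg4 k \<le> norm (c k) * s ^ deg4 k + norm (d k) * s ^ deg4 k" for k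
    using mult_right_mono[OF norm_triangle_ineq, of "s ^ deg4 k" "c k" "d k"] c(1)
    by (simp add: power_series_def ring_distribs)
  have sum: "((\<lambda>k. norm (c k) * s ^ deg4 k + norm (d k) * s ^ deg4 k) has_sum majorant s c + majorant s d) UNIV"
    by (rule has_sum_add[OF majorant_has_sum[OF c(1)] majorant_has_sum[OF d(1)]])
  have S: "(\<lambda>k. norm (c k + d k) * s ^ deg4 k) summable_on UNIV"
    by (rule summable_on_comparison_test[OF has_sum_imp_summable[OF sum] le])
      (use c in \<open>simp add: power_series_def\<close>)
  have ps: "power_series a s (\<lambda>k. c k + d k) (\<lambda>x. f x + g x)"
    using c(1) d(1) S by (auto simp: power_series_def scaleR_add_right intro: has_sum_add)
  have "majorant s (\<lambda>k. c k + d k) \<le> majorant s c + majorant s d"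
    by (rule has_sum_mono[OF majorant_has_sum[OF ps] sum]) (use le in auto)
  with ps c d show ?thesis
    unfolding majorized_def by (intro exI[of _ "\<lambda>k. c k + d k"]) auto
qed

lemma majorized_infsum:
  assumes "0 < s" "\<And>i. majorized a s (M i) (f i)" "M summable_on UNIV"
  shows "majorized a s (\<Sum>\<^sub>\<infinity>i. M i) (\<lambda>x. \<Sum>\<^sub>\<infinity>i. f i x)"
proof -
  obtain c where c: "\<And>i. power_series a s (c i) (f i)" "\<And>i. majorant s (c i) \<le> M i"
    using assms(2) unfolding majorized_def by metis
  have S: "(\<lambda>i. majorant s (c i)) summable_on UNIV"
    by (rule summable_on_comparison_test[OF assms(3) c(2)])
      (use \<open>0 < s\<close> in \<open>auto simp: majorant_def intro!: infsum_nonneg\<close>)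
  note * = power_series_infsum[OF \<open>0 < s\<close> c(1) S]
  have "(\<Sum>\<^sub>\<infinity>i. majorant s (c i)) \<le> (\<Sum>\<^sub>\<infinity>i. M i)"
    by (intro infsum_mono S assms c)
  with *(1,2) show ?thesis
    unfolding majorized_def by (meson order_trans)
qed

lemma majorized_mult:
  assumes "majorized a s M f" "majorized a s N g"
  shows "majorized a s (M * N) (\<lambda>x. f x * g x)"
proof -
  obtain c d where c: "power_series a s c f" "majorant s c \<le> M"
    and d: "power_series a s d g" "majorant s d \<le> N"
    using assms by (auto simp: majorized_def)
  have "0 < s" using c by (simp add: power_series_def)
  define e where "e l k = (if k \<in> range ((+) l) then c l * d (k - l) else 0)" for l k
  have inj: "inj ((+) l)" for l :: exp4
    by (auto simp: inj_def)
  have shift: "(h has_sum S) UNIV"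
    if "((\<lambda>j. h (l + j)) has_sum S) UNIV" "\<And>k. k \<notin> range ((+) l) \<Longrightarrow> h k = 0"
    for h :: "exp4 \<Rightarrow> 'z::{comm_monoid_add, topological_space}" and S l
  proof -
    have "(h has_sum S) (range ((+) l))"
      using that(1) by (simp add: has_sum_reindex[OF inj] o_def)
    then show ?thesis
      using has_sum_cong_neutral[of UNIV "range ((+) l)" h h S] that(2) by auto
  qed
  have eM: "((\<lambda>k. norm (e l k) * s ^ deg4 k) has_sum norm (c l) * s ^ deg4 l * majorant s d) UNIV" for l
  proof (rule shift)
    show "((\<lambda>j. norm (e l (l + j)) * s ^ deg4 (l + j)) has_sum norm (c l) * s ^ deg4 l * majorant s d) UNIV"
      using has_sum_cmult_right[OF majorant_has_sum[OF d(1)], of "norm (c l) * s ^ deg4 l"]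
      by (simp add: e_def norm_mult deg4_add power_add mult_ac)
  qed (simp add: e_def)
  then have Me: "majorant s (e l) = norm (c l) * s ^ deg4 l * majorant s d" for l
    unfolding majorant_def by (intro infsumI)
  have e: "power_series a s (e l) (\<lambda>x. (monom4 l (x - a) *\<^sub>R c l) * g x)" for l
    unfolding power_series_def
  proof (intro conjI allI impI \<open>0 < s\<close>)
    show "(\<lambda>k. norm (e l k) * s ^ deg4 k) summable_on UNIV"
      using eM by (rule has_sum_imp_summable)
    fix x assume "norm (x - a) < s"
    then have "((\<lambda>j. monom4 j (x - a) *\<^sub>R d j) has_sum g x) UNIV"
      using d(1) by (simp add: power_series_def)
    note * = has_sum_bounded_linear[OF bounded_linear_mult_right this, of "monom4 l (x - a) *\<^sub>R c l"]
    show "((\<lambda>k. monom4 k (x - a) *\<^sub>R e l k) has_sum monom4 l (x - a) *\<^sub>R c l * g x) UNIV"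
    proof (rule shift)
      show "((\<lambda>j. monom4 (l + j) (x - a) *\<^sub>R e l (l + j)) has_sum monom4 l (x - a) *\<^sub>R c l * g x) UNIV"
        using * by (simp add: e_def monom4_add mult_ac)
    qed (simp add: e_def)
  qed
  have sumM: "((\<lambda>l. norm (c l) * s ^ deg4 l * majorant s d) has_sum majorant s c * majorant s d) UNIV"
    by (rule has_sum_cmult_left[OF majorant_has_sum[OF c(1)]])
  have em: "majorized a s (norm (c l) * s ^ deg4 l * majorant s d) (\<lambda>x. (monom4 l (x - a) *\<^sub>R c l) * g x)" for l
    unfolding majorized_def using e[of l] Me[of l] by (intro exI[of _ "e l"]) simp
  have "majorized a s (\<Sum>\<^sub>\<infinity>l. norm (c l) * s ^ deg4 l * majorant s d)
      (\<lambda>x. \<Sum>\<^sub>\<infinity>l. (monom4 l (x - a) *\<^sub>R c l) * g x)"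
    by (rule majorized_infsum[OF \<open>0 < s\<close> em has_sum_imp_summable[OF sumM]])
  moreover have "(\<Sum>\<^sub>\<infinity>l. (monom4 l (x - a) *\<^sub>R c l) * g x) = f x * g x" if "norm (x - a) < s" for x
    using c(1) that
    by (intro infsumI has_sum_bounded_linear[OF bounded_linear_mult_left]) (simp add: power_series_def)
  ultimately have *: "majorized a s (majorant s c * majorant s d) (\<lambda>x. f x * g x)"
    using infsumI[OF sumM] by (auto intro: majorized_cong)
  have "majorant s c * majorant s d \<le> M * N"
    using c d \<open>0 < s\<close> by (intro mult_mono) (auto simp: majorant_def intro!: infsum_nonneg order_trans[OF infsum_nonneg c(2)[unfolded majorant_def]])
  with * show ?thesis
    unfolding majorized_def by (meson order_trans)
qed

lemma majorized_power: "majorized a s M f \<Longrightarrow> majorized a s (M ^ n) (\<lambda>x. f x ^ n)"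
proof (induction n)
  case 0
  then show ?case using majorized_const[of s a 1] majorizedD(1) by force
next
  case (Suc n)
  then show ?case using majorized_mult[of a s M f "M ^ n"] by simp
qed

lemma majorized_shrink:
  assumes "majorized a s M f" "0 < e"
  obtains t where "0 < t" "t \<le> s" "\<And>r. 0 < r \<Longrightarrow> r \<le> t \<Longrightarrow> majorized a r (norm (f a) + e) f"
proof -
  obtain c where c: "power_series a s c f"
    using assms by (auto simp: majorized_def)
  then have "0 < s" by (simp add: power_series_def)
  define m where "m = majorant s c"
  have "0 \<le> m" using \<open>0 < s\<close> by (auto simp: m_def majorant_def intro!: infsum_nonneg)
  define t where "t = min s (s * e / (m + 1))"
  have t: "0 < t" "t \<le> s"
    using \<open>0 < s\<close> \<open>0 < e\<close> \<open>0 \<le> m\<close> by (auto simp: t_def)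
  have small: "r / s * m \<le> e" if "0 < r" "r \<le> t" for r
  proof -
    have "r \<le> s * e / (m + 1)"
      using that by (simp add: t_def)
    then have "r * (m + 1) \<le> s * e"
      using \<open>0 \<le> m\<close> by (simp add: field_simps)
    then have "r * m \<le> s * e"
      using that by (simp add: algebra_simps)
    then show ?thesis
      using \<open>0 < s\<close> by (simp add: field_simps)
  qed
  show ?thesis
  proof (rule that[OF t])
    fix r :: real assume r: "0 < r" "r \<le> t"
    then have ps: "power_series a r c f"
      using power_series_mono[OF c] t by simp
    have "((\<lambda>k. if k = 0 then norm (c 0) else 0) has_sum (\<Sum>k\<in>{0}. if k = 0 then norm (c 0) else 0)) (UNIV :: exp4 set)"
      by (rule has_sum_finite_neutralI[where B="{0}"]) auto
    then have sum: "((\<lambda>k. (if k = 0 then norm (c 0) else 0) + r / s * (norm (c k) * s ^ deg4 k))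
        has_sum norm (c 0) + r / s * m) UNIV"
      unfolding m_def by (intro has_sum_add has_sum_cmult_right majorant_has_sum[OF c]) simp
    have "majorant r c \<le> norm (c 0) + r / s * m"
    proof (rule has_sum_mono[OF majorant_has_sum[OF ps] sum])
      fix k :: exp4
      show "norm (c k) * r ^ deg4 k \<le> (if k = 0 then norm (c 0) else 0) + r / s * (norm (c k) * s ^ deg4 k)"
      proof (cases "k = 0")
        case True
        then show ?thesis using r \<open>0 < s\<close> by simp
      next
        case False
        then obtain n where n: "deg4 k = Suc n"
          by (cases k; cases "deg4 k") (auto simp: zero_prod_def)
        have "r ^ n \<le> s ^ n"
          using r t by (intro power_mono) auto
        then have "norm (c k) * (r * r ^ n) \<le> norm (c k) * (r * s ^ n)"
          using r by (intro mult_left_mono) auto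
        also have "\<dots> = r / s * (norm (c k) * s ^ deg4 k)"
          using \<open>0 < s\<close> by (simp add: n)
        finally show ?thesis
          using False by (simp add: n)
      qed
    qed
    also have "\<dots> \<le> norm (f a) + e"
      using small[OF r] power_series_center[OF c] by simp
    finally show "majorized a r (norm (f a) + e) f"
      using ps by (auto simp: majorized_def)
  qed
qed

lemma majorized_mono: "majorized a s M f \<Longrightarrow> 0 < t \<Longrightarrow> t \<le> s \<Longrightarrow> \<exists>N. majorized a t N f"
  by (auto simp: majorized_def intro: power_series_mono)

definition analytic_at :: "quat \<Rightarrow> (quat \<Rightarrow> quat) \<Rightarrow> bool" where
  "analytic_at a f \<longleftrightarrow> (\<exists>s c. power_series a s c f)"

lemma analytic_at_majorized: "analytic_at a f \<longleftrightarrow> (\<exists>s M. majorized a s M f)"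
  by (auto simp: analytic_at_def majorized_def)

lemma analytic_at_majorized_common:
  assumes "analytic_at a f" "analytic_at a g"
  obtains s M N where "majorized a s M f" "majorized a s N g"
proof -
  obtain s t M N where "majorized a s M f" "majorized a t N g"
    using assms by (auto simp: analytic_at_majorized)
  then show ?thesis
    using majorized_mono[of a s M f "min s t"] majorized_mono[of a t N g "min s t"] that
    by (auto dest: majorizedD(1))
qed

lemma analytic_at_const: "analytic_at a (\<lambda>_. v)"
  using majorized_const[of 1 a v] by (auto simp: analytic_at_majorized)

lemma analytic_at_linear:
  assumes "bounded_linear L" "analytic_at a f"
  shows "analytic_at a (\<lambda>x. L (f x))"
  using assms(2) power_series_linear[OF assms(1)] unfolding analytic_at_def by blast

lemma analytic_at_add:
  assumes "analytic_at a f" "analytic_at a g"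
  shows "analytic_at a (\<lambda>x. f x + g x)"
proof -
  obtain s M N where "majorized a s M f" "majorized a s N g"
    using assms by (rule analytic_at_majorized_common)
  then show ?thesis
    unfolding analytic_at_majorized by (blast dest: majorized_add)
qed

lemma analytic_at_mult:
  assumes "analytic_at a f" "analytic_at a g"
  shows "analytic_at a (\<lambda>x. f x * g x)"
proof -
  obtain s M N where "majorized a s M f" "majorized a s N g"
    using assms by (rule analytic_at_majorized_common)
  then show ?thesis
    unfolding analytic_at_majorized by (blast dest: majorized_mult)
qed

lemma analytic_at_diff:
  "analytic_at a f \<Longrightarrow> analytic_at a g \<Longrightarrow> analytic_at a (\<lambda>x. f x - g x)"
  using analytic_at_add[of a f "\<lambda>x. - g x"] analytic_at_linear[OF bounded_linear_minus[OF bounded_linear_ident], of a g]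
  by simp

lemma analytic_at_ident: "analytic_at a (\<lambda>x. x)"
proof -
  define c :: "exp4 \<Rightarrow> quat" where
    "c = (\<lambda>_. 0)(0 := a, (1, 0, 0, 0) := 1, (0, 1, 0, 0) := e1, (0, 0, 1, 0) := e2, (0, 0, 0, 1) := e3)"
  let ?B = "{0, (1, 0, 0, 0), (0, 1, 0, 0), (0, 0, 1, 0), (0, 0, 0, 1)} :: exp4 set"
  have "power_series a 1 c (\<lambda>x. \<Sum>k\<in>?B. monom4 k (x - a) *\<^sub>R c k)"
    by (rule power_series_finite) (auto simp: c_def)
  moreover have "(\<Sum>k\<in>?B. monom4 k (x - a) *\<^sub>R c k) = x" for x
    by (simp add: c_def zero_prod_def quat_eq_iff e1_def e2_def e3_def)
  ultimately show ?thesis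
    by (auto simp: analytic_at_def)
qed

lemma geometric_has_sum_div_algebra:
  fixes u :: "'a::{real_normed_div_algebra, banach}"
  assumes "norm u < 1"
  shows "((\<lambda>n. u ^ n) has_sum inverse (1 - u)) UNIV"
proof -
  have sm: "summable (\<lambda>n. u ^ n)"
    using assms by (rule complete_algebra_summable_geometric)
  have "(\<Sum>n. u ^ n) = 1 + u * (\<Sum>n. u ^ n)"
    using suminf_split_head[OF sm] suminf_mult[OF sm, of u] by simp
  then have "(1 - u) * (\<Sum>n. u ^ n) = 1"
    unfolding left_diff_distrib mult_1_left by (simp only: diff_eq_eq)
  then have "(\<Sum>n. u ^ n) = inverse (1 - u)"
    by (metis inverse_unique)
  then show ?thesis
    using norm_summable_imp_has_sum[of "\<lambda>n. u ^ n"] sm assms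
    by (simp add: norm_power sums_iff)
qed

lemma analytic_at_inverse:
  assumes f: "analytic_at a f" and "f a \<noteq> 0"
  shows "analytic_at a (\<lambda>x. inverse (f x))"
proof -
  define u where "u x = 1 - inverse (f a) * f x" for x
  have "analytic_at a u"
    unfolding u_def by (intro analytic_at_diff analytic_at_mult analytic_at_const f)
  then obtain s M where M: "majorized a s M u"
    by (auto simp: analytic_at_majorized)
  obtain t where "0 < t" "\<And>r. 0 < r \<Longrightarrow> r \<le> t \<Longrightarrow> majorized a r (norm (u a) + 1 / 2) u"
    by (rule majorized_shrink[OF M, of "1 / 2"]) auto
  moreover have "u a = 0"
    using assms by (simp add: u_def)
  ultimately have t: "0 < t" "majorized a t (1 / 2) u"
    by (auto dest: meta_spec[of _ t])
  have "majorized a t (\<Sum>\<^sub>\<infinity>n. (1 / 2) ^ n) (\<lambda>x. \<Sum>\<^sub>\<infinity>n. u x ^ n)"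
    by (intro majorized_infsum majorized_power t)
      (use geometric_has_sum_div_algebra[of "1 / 2 :: real"] in \<open>auto intro: has_sum_imp_summable\<close>)
  then have "majorized a t (\<Sum>\<^sub>\<infinity>n. (1 / 2) ^ n) (\<lambda>x. inverse (f x) * f a)"
  proof (rule majorized_cong)
    fix x assume "norm (x - a) < t"
    then have "norm (u x) < 1"
      using majorizedD(3)[OF t(2), of x] by simp
    then have "(\<Sum>\<^sub>\<infinity>n. u x ^ n) = inverse (1 - u x)"
      by (intro infsumI geometric_has_sum_div_algebra)
    also have "\<dots> = inverse (f x) * f a"
      using assms by (cases "f x = 0") (simp_all add: u_def nonzero_inverse_mult_distrib)
    finally show "(\<Sum>\<^sub>\<infinity>n. u x ^ n) = inverse (f x) * f a" .
  qed
  then have "analytic_at a (\<lambda>x. inverse (f x) * f a)"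
    unfolding analytic_at_majorized by blast
  from analytic_at_mult[OF this analytic_at_const[of a "inverse (f a)"]] show ?thesis
    using assms by (simp add: mult.assoc)
qed

lemma power_series_has_derivative:
  assumes "power_series a s c f"
  shows "(f has_derivative (\<lambda>h. qre h *\<^sub>R c (1, 0, 0, 0) + qim1 h *\<^sub>R c (0, 1, 0, 0) +
      qim2 h *\<^sub>R c (0, 0, 1, 0) + qim3 h *\<^sub>R c (0, 0, 0, 1))) (at a)" (is "(f has_derivative ?L) _")
proof -
  have "0 < s" using assms by (simp add: power_series_def)
  let ?B = "{0, (1, 0, 0, 0), (0, 1, 0, 0), (0, 0, 1, 0), (0, 0, 0, 1)} :: exp4 set"
  let ?K = "majorant s c / s\<^sup>2"
  have rem: "norm (f x - f a - ?L (x - a)) \<le> ?K * (norm (x - a))\<^sup>2" if x: "norm (x - a) < s" for x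
  proof -
    let ?h = "x - a"
    have "((\<lambda>k. if k \<in> ?B then monom4 k ?h *\<^sub>R c k else 0) has_sum
        (\<Sum>k\<in>?B. if k \<in> ?B then monom4 k ?h *\<^sub>R c k else 0)) UNIV"
      by (rule has_sum_finite_neutralI[where B="?B"]) auto
    then have "((\<lambda>k. if k \<in> ?B then monom4 k ?h *\<^sub>R c k else 0) has_sum (c 0 + ?L ?h)) UNIV"
      by (simp add: zero_prod_def add_ac)
    then have "((\<lambda>k. monom4 k ?h *\<^sub>R c k + - (if k \<in> ?B then monom4 k ?h *\<^sub>R c k else 0)) has_sum
        f x + - (c 0 + ?L ?h)) UNIV"
      using assms x by (intro has_sum_add has_sum_uminusI) (simp add: power_series_def)
    moreover have "f x + - (c 0 + ?L ?h) = f x - f a - ?L ?h"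
      by (simp add: power_series_center[OF assms])
    ultimately have R: "((\<lambda>k. monom4 k ?h *\<^sub>R c k + - (if k \<in> ?B then monom4 k ?h *\<^sub>R c k else 0)) has_sum
        (f x - f a - ?L ?h)) UNIV"
      by metis
    have "norm (f x - f a - ?L ?h) \<le> (norm ?h)\<^sup>2 / s\<^sup>2 * majorant s c"
    proof (rule norm_infsum_le[OF R has_sum_cmult_right[OF majorant_has_sum[OF assms]]])
      fix k :: exp4
      show "norm (monom4 k ?h *\<^sub>R c k + - (if k \<in> ?B then monom4 k ?h *\<^sub>R c k else 0))
          \<le> (norm ?h)\<^sup>2 / s\<^sup>2 * (norm (c k) * s ^ deg4 k)"
      proof (cases "k \<in> ?B")
        case True
        then show ?thesis using \<open>0 < s\<close> by simp
      next
        case False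
        have "2 \<le> deg4 k"
        proof (rule ccontr)
          assume *: "\<not> 2 \<le> deg4 k"
          obtain k0 k1 k2 k3 where k: "k = (k0, k1, k2, k3)" by (cases k)
          have "k0 + k1 + k2 + k3 = 0 \<or> k0 + k1 + k2 + k3 = 1"
            using * by (auto simp: k)
          then show False
            using False by (auto simp: k zero_prod_def add_is_1)
        qed
        then obtain n where n: "deg4 k = 2 + n"
          using le_Suc_ex by blast
        have "\<bar>monom4 k ?h\<bar> \<le> (norm ?h)\<^sup>2 * norm ?h ^ n"
          using abs_monom4_le[of k ?h] by (simp add: n power2_eq_square mult.assoc)
        also have "\<dots> \<le> (norm ?h)\<^sup>2 * s ^ n"
          using x by (intro mult_left_mono power_mono) auto
        also have "\<dots> = (norm ?h)\<^sup>2 / s\<^sup>2 * s ^ deg4 k"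
          using \<open>0 < s\<close> by (simp add: n power2_eq_square)
        finally have "\<bar>monom4 k ?h\<bar> * norm (c k) \<le> (norm ?h)\<^sup>2 / s\<^sup>2 * s ^ deg4 k * norm (c k)"
          by (rule mult_right_mono) simp
        with False show ?thesis
          by (simp add: mult_ac)
      qed
    qed
    then show ?thesis by (simp add: mult_ac)
  qed
  show ?thesis
  proof (rule has_derivativeI_sandwich[OF \<open>0 < s\<close>])
    show "bounded_linear ?L"
      by (rule linear_conv_bounded_linear[THEN iffD1]) (rule linearI; simp add: algebra_simps)
    show "((\<lambda>y. ?K * norm (y - a)) \<longlongrightarrow> 0) (at a)"
      by (rule tendsto_eq_intros refl | simp)+
    fix y assume y: "y \<noteq> a" "dist y a < s"
    have "norm (f y - f a - ?L (y - a)) / norm (y - a) \<le> ?K * (norm (y - a))\<^sup>2 / norm (y - a)"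
      using rem[of y] y by (intro divide_right_mono) (auto simp: dist_norm)
    also have "\<dots> = ?K * norm (y - a)"
      using y by (simp add: power2_eq_square)
    finally show "norm (f y - f a - ?L (y - a)) / norm (y - a) \<le> ?K * norm (y - a)" .
  qed
qed

lemma real_analytic_on_iff:
  assumes "open U"
  shows "real_analytic_on f U \<longleftrightarrow> (\<forall>a\<in>U. analytic_at a f)"
proof
  assume f: "real_analytic_on f U"
  show "\<forall>a\<in>U. analytic_at a f"
  proof
    fix a assume "a \<in> U"
    then obtain c \<rho> where "0 < \<rho>" and c: "\<And>x. x \<in> ball a \<rho> \<Longrightarrow>
        ((\<lambda>k. monom4 k (x - a) *\<^sub>R c k) has_sum f x) UNIV"
      using f unfolding real_analytic_on_def monom4_scaleR_eq_case_prod by blast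
    define s where "s = \<rho> / 4"
    have s: "0 < s" "4 * s = \<rho>" using \<open>0 < \<rho>\<close> by (auto simp: s_def)
    define h where "h = Quat s s s s"
    have "(norm h)\<^sup>2 = (2 * s)\<^sup>2"
      unfolding quat_norm_square h_def by (simp add: power_mult_distrib)
    then have "norm h = 2 * s"
      by (rule power2_eq_imp_eq) (use s in simp_all)
    then have "a + h \<in> ball a \<rho>"
      using s by (simp add: dist_norm)
    from c[OF this] have "(\<lambda>k. monom4 k h *\<^sub>R c k) summable_on UNIV"
      by (simp add: has_sum_imp_summable)
    then have "(\<lambda>k. norm (monom4 k h *\<^sub>R c k)) summable_on UNIV"
      by (rule summable_on_imp_abs_summable_on_euclidean)
    moreover have "norm (monom4 k h *\<^sub>R c k) = norm (c k) * s ^ deg4 k" for k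
      using s by (cases k) (simp add: h_def power_add abs_mult mult_ac)
    ultimately have "(\<lambda>k. norm (c k) * s ^ deg4 k) summable_on UNIV"
      by (simp only:)
    then have "power_series a s c f"
      using c s by (simp add: power_series_def dist_norm norm_minus_commute)
    then show "analytic_at a f"
      by (auto simp: analytic_at_def)
  qed
next
  assume f: "\<forall>a\<in>U. analytic_at a f"
  show "real_analytic_on f U"
    unfolding real_analytic_on_def
  proof
    fix a assume "a \<in> U"
    then obtain s c where c: "power_series a s c f"
      using f by (auto simp: analytic_at_def)
    obtain r where r: "0 < r" "ball a r \<subseteq> U"
      by (rule openE[OF assms \<open>a \<in> U\<close>])
    show "\<exists>c. \<exists>\<rho>>0. ball a \<rho> \<subseteq> U \<and>
        (\<forall>x\<in>ball a \<rho>.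
          ((\<lambda>(k0 :: nat, k1 :: nat, k2 :: nat, k3 :: nat).
              (qre (x - a) ^ k0 * qim1 (x - a) ^ k1 * qim2 (x - a) ^ k2 * qim3 (x - a) ^ k3)
                *\<^sub>R c (k0, k1, k2, k3))
            has_sum f x) UNIV)"
    proof (intro exI conjI ballI)
      show "0 < min r s" using r c by (simp add: power_series_def)
      show "ball a (min r s) \<subseteq> U" using r by auto
      fix x assume "x \<in> ball a (min r s)"
      then have "((\<lambda>k. monom4 k (x - a) *\<^sub>R c k) has_sum f x) UNIV"
        using c by (simp add: power_series_def dist_norm norm_minus_commute)
      then show "((\<lambda>(k0, k1, k2, k3).
          (qre (x - a) ^ k0 * qim1 (x - a) ^ k1 * qim2 (x - a) ^ k2 * qim3 (x - a) ^ k3) *\<^sub>R c (k0, k1, k2, k3))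
          has_sum f x) UNIV"
        unfolding monom4_scaleR_eq_case_prod .
    qed
  qed
qed

section \<open>The operator \<open>V_q\<close>\<close>

lemma qvec_eq: "qvec x = qim1 x *\<^sub>R e1 + qim2 x *\<^sub>R e2 + qim3 x *\<^sub>R e3"
  by (simp add: quat_eq_iff qvec_def e1_def e2_def e3_def)

lemma qvec_simps [simp]:
  "qre (qvec x) = 0" "qim1 (qvec x) = qim1 x" "qim2 (qvec x) = qim2 x" "qim3 (qvec x) = qim3 x"
  by (simp_all add: qvec_def)

lemma bounded_linear_quat_parts:
  "bounded_linear qre" "bounded_linear qim1" "bounded_linear qim2" "bounded_linear qim3" "bounded_linear qvec"
  by (rule linear_conv_bounded_linear[THEN iffD1], rule linearI; simp add: quat_eq_iff)+

lemma of_real_quat_parts [simp]: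
  "qre (of_real r) = r" "qim1 (of_real r) = 0" "qim2 (of_real r) = 0" "qim3 (of_real r) = 0"
  by (simp_all add: of_real_def)

lemma has_derivative_along_line:
  assumes "(f has_derivative D) (at (a + t *\<^sub>R e))"
  shows "((\<lambda>t. f (a + t *\<^sub>R e)) has_vector_derivative D e) (at t)"
proof -
  interpret bounded_linear D using assms by (rule has_derivative_bounded_linear)
  have "((\<lambda>t. a + t *\<^sub>R e) has_derivative (\<lambda>h. h *\<^sub>R e)) (at t)"
    by (auto intro!: derivative_eq_intros)
  from has_derivative_compose[OF this assms] show ?thesis
    by (simp add: has_vector_derivative_def scaleR)
qed

lemma derivative_along_line_unique:
  assumes "(f has_derivative D) (at a)" "((\<lambda>t. f (a + t *\<^sub>R e)) has_vector_derivative d) (at 0)"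
  shows "D e = d"
  using vector_derivative_unique_at[OF has_derivative_along_line[of f D a 0 e] assms(2)] assms(1) by simp

lemma Vq_eq:
  assumes "(f has_derivative D) (at a)"
  shows "Vq f a = D 1 - inverse (qvec a) * D (qvec a)"
proof -
  interpret bounded_linear D using assms by (rule has_derivative_bounded_linear)
  have "pderiv_dir e f a = D e" for e
    using has_derivative_along_line[of f D a 0 e] assms
    unfolding pderiv_dir_def by (auto intro: vector_derivative_at)
  moreover have "D (qvec a) = qim1 a *\<^sub>R D e1 + qim2 a *\<^sub>R D e2 + qim3 a *\<^sub>R D e3"
    unfolding qvec_eq by (simp only: add scaleR)
  ultimately show ?thesis
    unfolding Vq_def by simp
qed

definition Vq_regular_at :: "quat \<Rightarrow> (quat \<Rightarrow> quat) \<Rightarrow> bool" where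
  "Vq_regular_at a f \<longleftrightarrow> analytic_at a f \<and> Vq f a = 0"

lemma analytic_at_derivative:
  assumes "analytic_at a f"
  obtains D where "(f has_derivative D) (at a)"
  using assms power_series_has_derivative unfolding analytic_at_def by blast

lemma Vq_regular_on_iff: "open U \<Longrightarrow> Vq_regular_on f U \<longleftrightarrow> (\<forall>a\<in>U. Vq_regular_at a f)"
  by (auto simp: Vq_regular_on_def Vq_regular_at_def real_analytic_on_iff)

lemma Vq_regular_at_derivative:
  assumes "Vq_regular_at a f"
  obtains D where "(f has_derivative D) (at a)" "D 1 = inverse (qvec a) * D (qvec a)"
proof -
  obtain D where D: "(f has_derivative D) (at a)"
    using assms analytic_at_derivative by (auto simp: Vq_regular_at_def)
  with assms that show ?thesis
    by (simp add: Vq_regular_at_def Vq_eq[OF D])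
qed

lemma Vq_regular_at_cong:
  assumes "open U" "a \<in> U" "\<And>x. x \<in> U \<Longrightarrow> f x = g x" "Vq_regular_at a f"
  shows "Vq_regular_at a g"
proof -
  obtain s c where c: "power_series a s c f"
    using assms by (auto simp: Vq_regular_at_def analytic_at_def)
  obtain r where r: "0 < r" "ball a r \<subseteq> U"
    by (rule openE[OF assms(1,2)])
  have "0 < s" using c by (simp add: power_series_def)
  have "power_series a (min r s) c f"
    by (rule power_series_mono[OF c]) (use r \<open>0 < s\<close> in auto)
  then have "power_series a (min r s) c g"
    by (rule power_series_cong) (use r assms(3) in \<open>auto simp: subset_eq dist_norm norm_minus_commute\<close>)
  moreover obtain D where D: "(f has_derivative D) (at a)" "D 1 = inverse (qvec a) * D (qvec a)"
    using Vq_regular_at_derivative[OF assms(4)] .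
  have "(g has_derivative D) (at a)"
    using has_derivative_transform_within_open[OF D(1) assms(1,2)] assms(3) by blast
  from Vq_eq[OF this] D(2) have "Vq g a = 0" by simp
  ultimately show ?thesis
    by (auto simp: Vq_regular_at_def analytic_at_def)
qed

lemma Vq_regular_at_const: "Vq_regular_at a (\<lambda>_. v)"
  using Vq_eq[OF has_derivative_const[of v "at a"]] by (simp add: Vq_regular_at_def analytic_at_const)

lemma Vq_regular_at_add:
  assumes "Vq_regular_at a f" "Vq_regular_at a g"
  shows "Vq_regular_at a (\<lambda>x. f x + g x)"
proof -
  obtain D E where D: "(f has_derivative D) (at a)" "D 1 = inverse (qvec a) * D (qvec a)"
    and E: "(g has_derivative E) (at a)" "E 1 = inverse (qvec a) * E (qvec a)"
    using assms Vq_regular_at_derivative by metis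
  show ?thesis
    using Vq_eq[OF has_derivative_add[OF D(1) E(1)]] D(2) E(2) assms
    by (simp add: Vq_regular_at_def analytic_at_add distrib_left)
qed

lemma Vq_regular_at_sum:
  "finite I \<Longrightarrow> (\<And>i. i \<in> I \<Longrightarrow> Vq_regular_at a (f i)) \<Longrightarrow> Vq_regular_at a (\<lambda>x. \<Sum>i\<in>I. f i x)"
  by (induction I rule: finite_induct) (simp_all add: Vq_regular_at_const Vq_regular_at_add)

lemma Vq_regular_at_mult:
  assumes "Vq_regular_at a f" "Vq_regular_at a g"
    and comm: "f a * inverse (qvec a) = inverse (qvec a) * f a"
  shows "Vq_regular_at a (\<lambda>x. f x * g x)"
proof -
  obtain D E where D: "(f has_derivative D) (at a)" "D 1 = inverse (qvec a) * D (qvec a)"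
    and E: "(g has_derivative E) (at a)" "E 1 = inverse (qvec a) * E (qvec a)"
    using assms Vq_regular_at_derivative by metis
  have "f a * E 1 = inverse (qvec a) * (f a * E (qvec a))"
    by (simp add: E(2) mult.assoc[symmetric] comm)
  then have "Vq (\<lambda>x. f x * g x) a = 0"
    using D(2) by (simp add: Vq_eq[OF has_derivative_mult[OF D(1) E(1)]] distrib_left mult.assoc)
  with assms show ?thesis
    by (simp add: Vq_regular_at_def analytic_at_mult)
qed

lemma Vq_regular_at_mult_const:
  assumes "Vq_regular_at a f"
  shows "Vq_regular_at a (\<lambda>x. f x * v)"
proof -
  obtain D where D: "(f has_derivative D) (at a)" "D 1 = inverse (qvec a) * D (qvec a)"
    using Vq_regular_at_derivative[OF assms] .
  from Vq_eq[OF has_derivative_mult_left[OF D(1)], of v] assms D(2) show ?thesis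
    by (simp add: Vq_regular_at_def analytic_at_mult analytic_at_const mult.assoc)
qed

lemma Vq_regular_at_infsum:
  assumes "0 < s" "\<And>i. majorized a s (M i) (f i)" "M summable_on UNIV"
    and reg: "\<And>i. Vq_regular_at a (f i)"
  shows "Vq_regular_at a (\<lambda>x. \<Sum>\<^sub>\<infinity>i. f i x)"
proof -
  obtain c where c: "\<And>i. power_series a s (c i) (f i)" "\<And>i. majorant s (c i) \<le> M i"
    using assms(2) unfolding majorized_def by metis
  have "(\<lambda>i. majorant s (c i)) summable_on UNIV"
    by (rule summable_on_comparison_test[OF assms(3) c(2)])
      (use \<open>0 < s\<close> in \<open>auto simp: majorant_def intro!: infsum_nonneg\<close>)
  note * = power_series_infsum[OF \<open>0 < s\<close> c(1) this]
  define V where "V c = c (1, 0, 0, 0) - inverse (qvec a) * (qim1 a *\<^sub>R c (0, 1, 0, 0) +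
      qim2 a *\<^sub>R c (0, 0, 1, 0) + qim3 a *\<^sub>R c (0, 0, 0, 1))" for c :: "exp4 \<Rightarrow> quat"
  have V: "Vq g a = V d" if "power_series a s d g" for g d
    by (simp add: Vq_eq[OF power_series_has_derivative[OF that]] V_def)
  have "((\<lambda>i. c i k) has_sum (\<Sum>\<^sub>\<infinity>i. c i k)) UNIV" for k
    using *(3) by (rule has_sum_infsum)
  then have "((\<lambda>i. V (c i)) has_sum V (\<lambda>k. \<Sum>\<^sub>\<infinity>i. c i k)) UNIV"
    unfolding V_def diff_conv_add_uminus
    by (intro has_sum_add has_sum_uminusI has_sum_bounded_linear[OF bounded_linear_mult_right] has_sum_scaleR)
  moreover have "V (c i) = 0" for i
    using reg[of i] V[OF c(1)[of i]] by (simp add: Vq_regular_at_def)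
  ultimately have "V (\<lambda>k. \<Sum>\<^sub>\<infinity>i. c i k) = 0"
    using has_sum_unique[OF _ has_sum_0_simp] by auto
  then show ?thesis
    using *(1) V[OF *(1)] by (auto simp: Vq_regular_at_def analytic_at_def)
qed


section \<open>The variables \<open>\<mu>\<close>\<close>

lemma mu_commute: "mu t a * inverse (qvec a) = inverse (qvec a) * mu t a"
  by (simp add: mu_def divide_quat_def distrib_left distrib_right of_real_def)

lemma Vq_regular_at_linear_mu:
  assumes "qvec a \<noteq> 0" and L: "bounded_linear L" "\<And>x. L (qvec x) = L x"
  shows "Vq_regular_at a (\<lambda>x. mu (L x) x)"
proof -
  interpret L: bounded_linear L by fact
  have of_real_L: "analytic_at a (\<lambda>x. of_real (L' x) :: quat)" if "bounded_linear L'" for L'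
    using analytic_at_linear[OF bounded_linear_compose[OF bounded_linear_of_real that] analytic_at_ident]
    by simp
  have an: "analytic_at a (\<lambda>x. of_real (L x) * (1 + of_real (qre x) * inverse (qvec x)))"
    by (intro analytic_at_mult analytic_at_add analytic_at_const of_real_L L bounded_linear_quat_parts
        analytic_at_inverse analytic_at_linear[OF bounded_linear_quat_parts(5) analytic_at_ident] assms)
  have mu_eq: "mu (L x) x = of_real (L x) * (1 + of_real (qre x) * inverse (qvec x))" for x
    by (simp add: mu_def divide_quat_def scaleR_conv_of_real)
  have an': "analytic_at a (\<lambda>x. mu (L x) x)"
    unfolding mu_eq by (rule an)
  then obtain D where D: "(((\<lambda>x. mu (L x) x)) has_derivative D) (at a)"
    by (rule analytic_at_derivative)
  have L1: "L 1 = 0"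
    using L(2)[of 1] by (simp add: qvec_def quat_eq_iff zero_quat_def[symmetric])
  have qv: "qvec (a + t *\<^sub>R 1) = qvec a" "qvec (a + t *\<^sub>R qvec a) = (1 + t) *\<^sub>R qvec a" for t
    by (simp_all add: quat_eq_iff algebra_simps)
  have "mu (L (a + t *\<^sub>R 1)) (a + t *\<^sub>R 1) = L a *\<^sub>R (1 + of_real (qre a + t) * inverse (qvec a))" for t
    by (simp add: mu_def divide_quat_def qv L.add L.scaleR L1 del: scaleR_one)
  then have "((\<lambda>t. mu (L (a + t *\<^sub>R 1)) (a + t *\<^sub>R 1)) has_vector_derivative L a *\<^sub>R inverse (qvec a)) (at 0)"
    by (auto intro!: derivative_eq_intros simp: of_real_def)
  from derivative_along_line_unique[OF D this] have 1: "D 1 = L a *\<^sub>R inverse (qvec a)" .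
  have *: "L a *\<^sub>R ((1 + t) *\<^sub>R 1 + of_real (qre a) * inverse (qvec a)) =
      mu (L (a + t *\<^sub>R qvec a)) (a + t *\<^sub>R qvec a)" if "t \<in> {-1<..<1}" for t :: real
  proof -
    from that have t: "1 + t \<noteq> 0" by auto
    have "L (a + t *\<^sub>R qvec a) = (1 + t) * L a"
      by (simp add: L.add L.scaleR L(2) algebra_simps)
    then have "mu (L (a + t *\<^sub>R qvec a)) (a + t *\<^sub>R qvec a) =
        ((1 + t) * L a) *\<^sub>R (1 + qre a *\<^sub>R (inverse (1 + t) *\<^sub>R inverse (qvec a)))"
      by (simp add: mu_def divide_quat_def qv of_real_def inverse_scaleR_distrib)
    then show ?thesis
      using t by (simp add: scaleR_add_right of_real_def mult_ac)
  qed
  have "((\<lambda>t. L a *\<^sub>R ((1 + t) *\<^sub>R 1 + of_real (qre a) * inverse (qvec a))) has_vector_derivative L a *\<^sub>R 1) (at 0)"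
    by (auto intro!: derivative_eq_intros)
  then have "((\<lambda>t. mu (L (a + t *\<^sub>R qvec a)) (a + t *\<^sub>R qvec a)) has_vector_derivative L a *\<^sub>R 1) (at 0)"
    by (rule has_vector_derivative_transform_within_open[where S="{-1<..<1}"]) (use * in auto)
  from derivative_along_line_unique[OF D this] have "D (qvec a) = L a *\<^sub>R 1" .
  then show ?thesis
    using an' 1 Vq_eq[OF D] by (simp add: Vq_regular_at_def)
qed

lemma mu_eq: "mu t x = t *\<^sub>R mu 1 x"
  by (simp add: mu_def)

lemma mu_1_mult_qvec: "qvec x \<noteq> 0 \<Longrightarrow> mu 1 x * qvec x = x"
  by (simp add: mu_def divide_quat_def distrib_right mult.assoc quat_eq_iff)

lemma norm_mu_1: "qvec x \<noteq> 0 \<Longrightarrow> norm (mu 1 x) = norm x / norm (qvec x)"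
  using arg_cong[OF mu_1_mult_qvec, of x norm] by (simp add: norm_mult field_simps)

lemma mu_pow_eq: "mu_pow (a1, a2, a3) x = (qim1 x ^ a1 * qim2 x ^ a2 * qim3 x ^ a3) *\<^sub>R mu 1 x ^ (a1 + a2 + a3)"
  unfolding mu_pow.simps mu_eq[of "qim1 x"] mu_eq[of "qim2 x"] mu_eq[of "qim3 x"]
  by (simp add: scaleR_power power_add mult_ac)

lemma mu_pow_purely_vectorial:
  "qre x = 0 \<Longrightarrow> mu_pow (a1, a2, a3) x = of_real (qim1 x ^ a1 * qim2 x ^ a2 * qim3 x ^ a3)"
  unfolding mu_pow_eq by (simp add: mu_def scaleR_conv_of_real)

lemma sum_norm_mu_sq:
  assumes "qvec x \<noteq> 0"
  shows "(norm (mu (qim1 x) x))\<^sup>2 + (norm (mu (qim2 x) x))\<^sup>2 + (norm (mu (qim3 x) x))\<^sup>2 = (norm x)\<^sup>2"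
proof -
  have q: "(norm (qvec x))\<^sup>2 = (qim1 x)\<^sup>2 + (qim2 x)\<^sup>2 + (qim3 x)\<^sup>2"
    by (simp add: quat_norm_square)
  have "(norm (mu (qim1 x) x))\<^sup>2 + (norm (mu (qim2 x) x))\<^sup>2 + (norm (mu (qim3 x) x))\<^sup>2 =
      (norm (qvec x))\<^sup>2 * (norm (mu 1 x))\<^sup>2"
    unfolding mu_eq[of "qim1 x"] mu_eq[of "qim2 x"] mu_eq[of "qim3 x"] q
    by (simp add: power_mult_distrib algebra_simps)
  also have "\<dots> = (norm x)\<^sup>2"
    using assms by (simp add: norm_mu_1 power_divide)
  finally show ?thesis .
qed

fun mpow :: "midx \<Rightarrow> real \<Rightarrow> real \<Rightarrow> real \<Rightarrow> real" where
  "mpow (a1, a2, a3) t1 t2 t3 = t1 ^ a1 * t2 ^ a2 * t3 ^ a3"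

lemma mpow_nonneg: "0 \<le> t1 \<Longrightarrow> 0 \<le> t2 \<Longrightarrow> 0 \<le> t3 \<Longrightarrow> 0 \<le> mpow \<alpha> t1 t2 t3"
  by (cases \<alpha>) simp

lemma mpow_power: "(mpow \<alpha> t1 t2 t3)\<^sup>2 = mpow \<alpha> (t1\<^sup>2) (t2\<^sup>2) (t3\<^sup>2)"
  by (cases \<alpha>) (simp add: power_mult_distrib power_mult[symmetric] mult.commute)

lemma norm_mu_pow:
  "norm (mu_pow \<alpha> x) = mpow \<alpha> (norm (mu (qim1 x) x)) (norm (mu (qim2 x) x)) (norm (mu (qim3 x) x))"
  by (cases \<alpha>) (simp add: norm_mult norm_power)

lemma multinom_pos: "0 < multinom \<alpha>"
  by (cases \<alpha>) simp

lemma multinom_eq: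
  "multinom (a1, a2, a3) = real ((a1 + a2 + a3) choose a1) * real ((a2 + a3) choose a2)"
  by (simp add: binomial_fact add.assoc)

lemma trinomial_theorem:
  fixes t1 t2 t3 :: real
  shows "(\<Sum>\<alpha>\<in>{(a1, a2, a3). a1 + a2 + a3 = n}. mpow \<alpha> t1 t2 t3 * multinom \<alpha>) = (t1 + t2 + t3) ^ n"
    and "finite {(a1, a2, a3). a1 + a2 + a3 = (n :: nat)}"
proof -
  let ?S = "Sigma {..n} (\<lambda>i. {..n - i})"
  have img: "{(a1, a2, a3). a1 + a2 + a3 = n} = (\<lambda>(i, j). (i, j, n - i - j)) ` ?S"
    by (force simp: image_iff)
  then show "finite {(a1, a2, a3). a1 + a2 + a3 = (n :: nat)}"
    by simp
  have "(t1 + t2 + t3) ^ n = (\<Sum>i\<le>n. real (n choose i) * t1 ^ i * (t2 + t3) ^ (n - i))"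
    unfolding add.assoc by (rule binomial_ring)
  also have "\<dots> = (\<Sum>i\<le>n. \<Sum>j\<le>n - i. real (n choose i) * t1 ^ i *
      (real ((n - i) choose j) * t2 ^ j * t3 ^ (n - i - j)))"
    by (simp add: binomial_ring sum_distrib_left)
  also have "\<dots> = (\<Sum>(i, j)\<in>?S. real (n choose i) * t1 ^ i * (real ((n - i) choose j) * t2 ^ j * t3 ^ (n - i - j)))"
    by (rule sum.Sigma) auto
  also have "\<dots> = (\<Sum>\<alpha>\<in>(\<lambda>(i, j). (i, j, n - i - j)) ` ?S. mpow \<alpha> t1 t2 t3 * multinom \<alpha>)"
    by (subst sum.reindex) (auto simp: inj_on_def multinom_eq mult_ac intro!: sum.cong simp del: multinom.simps)
  finally show "(\<Sum>\<alpha>\<in>{(a1, a2, a3). a1 + a2 + a3 = n}. mpow \<alpha> t1 t2 t3 * multinom \<alpha>) = (t1 + t2 + t3) ^ n"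
    by (simp add: img)
qed

lemma multinom_summable_iff:
  assumes "0 \<le> t1" "0 \<le> t2" "0 \<le> t3"
  shows "(\<lambda>\<alpha>. mpow \<alpha> t1 t2 t3 * multinom \<alpha>) summable_on UNIV \<longleftrightarrow> t1 + t2 + t3 < 1"
proof -
  let ?B = "\<lambda>n. {(a1, a2, a3). a1 + a2 + a3 = (n :: nat)}"
  have "(\<lambda>\<alpha>. mpow \<alpha> t1 t2 t3 * multinom \<alpha>) summable_on (\<Union>n\<in>UNIV. ?B n) \<longleftrightarrow>
      (\<lambda>n. (t1 + t2 + t3) ^ n) summable_on UNIV"
  proof (rule summable_on_Union_iff)
    show "((\<lambda>\<alpha>. mpow \<alpha> t1 t2 t3 * multinom \<alpha>) has_sum (t1 + t2 + t3) ^ n) (?B n)" for n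
      using trinomial_theorem(1)[where n=n, of t1 t2 t3] by (intro has_sum_finiteI trinomial_theorem(2)) simp
    show "0 \<le> mpow \<alpha> t1 t2 t3 * multinom \<alpha>" for \<alpha>
      using mpow_nonneg[OF assms] multinom_pos[of \<alpha>] by (simp add: less_imp_le)
  qed (auto simp: disjoint_family_on_def)
  moreover have "(\<Union>n\<in>UNIV. ?B n) = UNIV" by auto
  moreover have "(\<lambda>n. (t1 + t2 + t3) ^ n) summable_on UNIV \<longleftrightarrow> t1 + t2 + t3 < 1"
    using assms by (subst summable_on_UNIV_nonneg_real_iff) auto
  ultimately show ?thesis by simp
qed

lemma Omega_A_iff: "x \<in> Omega_A \<longleftrightarrow> qvec x \<noteq> 0 \<and> norm x < 1"
proof (cases "qvec x = 0")
  case False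
  have "(\<lambda>\<alpha>. (norm (mu_pow \<alpha> x))\<^sup>2 * multinom \<alpha>) summable_on UNIV \<longleftrightarrow> (norm x)\<^sup>2 < 1"
    unfolding norm_mu_pow mpow_power sum_norm_mu_sq[OF False, symmetric]
    by (rule multinom_summable_iff) auto
  with False show ?thesis
    by (simp add: Omega_A_def abs_square_less_1)
qed (simp add: Omega_A_def)

lemma open_Omega_A: "open Omega_A"
proof -
  have eq: "Omega_A = {x. qvec x \<noteq> 0} \<inter> {x. norm x < 1}"
    by (auto simp: Omega_A_iff)
  have "continuous_on UNIV qvec"
    by (intro linear_continuous_on bounded_linear_quat_parts)
  then have "open {x. qvec x \<noteq> 0}"
    by (intro open_Collect_neq continuous_on_const) auto
  then show ?thesis
    unfolding eq by (intro open_Int open_Collect_less continuous_intros)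
qed

lemma Vq_regular_at_mu:
  assumes "qvec a \<noteq> 0"
  shows "Vq_regular_at a (\<lambda>x. mu (qim1 x) x)" "Vq_regular_at a (\<lambda>x. mu (qim2 x) x)"
    "Vq_regular_at a (\<lambda>x. mu (qim3 x) x)"
  by (rule Vq_regular_at_linear_mu[OF assms bounded_linear_quat_parts(2)] Vq_regular_at_linear_mu[OF assms bounded_linear_quat_parts(3)]
      Vq_regular_at_linear_mu[OF assms bounded_linear_quat_parts(4)], simp)+

lemma Vq_regular_at_mu_power_mult:
  assumes "Vq_regular_at a (\<lambda>x. mu (L x) x)" "Vq_regular_at a f"
  shows "Vq_regular_at a (\<lambda>x. mu (L x) x ^ n * f x)"
proof (induction n)
  case (Suc n)
  then show ?case
    using Vq_regular_at_mult[OF assms(1) Suc mu_commute] by (simp add: mult.assoc)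
qed (use assms in simp)

lemma Vq_regular_at_mu_pow_mult:
  assumes "qvec a \<noteq> 0" "Vq_regular_at a f"
  shows "Vq_regular_at a (\<lambda>x. mu_pow \<alpha> x * f x)"
proof (cases \<alpha>)
  case (fields a1 a2 a3)
  show ?thesis
    unfolding fields mu_pow.simps mult.assoc
    by (intro Vq_regular_at_mu_power_mult Vq_regular_at_mu assms)
qed

definition weighted_summable :: "(midx \<Rightarrow> quat) \<Rightarrow> bool" where
  "weighted_summable c \<longleftrightarrow> (\<lambda>\<alpha>. (norm (c \<alpha>))\<^sup>2 / multinom \<alpha>) summable_on UNIV"

lemma square_summable_iff_weighted_summable:
  "square_summable (\<lambda>\<alpha>. (1 / sqrt (multinom \<alpha>)) *\<^sub>R c \<alpha>) \<longleftrightarrow> weighted_summable c"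
  unfolding weighted_summable_def square_summable_def
  by (intro summable_on_cong) (simp add: power_mult_distrib power_divide multinom_pos less_imp_le)

lemma mpow_mult_weighted_summable:
  assumes "0 \<le> t1" "0 \<le> t2" "0 \<le> t3" "t1\<^sup>2 + t2\<^sup>2 + t3\<^sup>2 < 1" "weighted_summable c"
  shows "(\<lambda>\<alpha>. mpow \<alpha> t1 t2 t3 * norm (c \<alpha>)) summable_on UNIV"
proof -
  have "square_summable (\<lambda>\<alpha>. sqrt (multinom \<alpha>) * mpow \<alpha> t1 t2 t3)"
    using multinom_summable_iff[of "t1\<^sup>2" "t2\<^sup>2" "t3\<^sup>2"] assms
    by (simp add: square_summable_def power_mult_distrib mpow_power multinom_pos less_imp_le mult.commute)
  from norm_mult_summable_on[OF this square_summable_iff_weighted_summable[THEN iffD2, OF assms(5)]]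
  show ?thesis
    by (simp add: norm_mult abs_mult mpow_nonneg assms multinom_pos less_imp_le)
      (simp add: multinom_pos less_imp_neq[symmetric])
qed

lemma mu_pow_mult_abs_summable:
  assumes "x \<in> Omega_A" "weighted_summable c"
  shows "(\<lambda>\<alpha>. norm (mu_pow \<alpha> x) * norm (c \<alpha>)) summable_on UNIV"
  unfolding norm_mu_pow
  by (rule mpow_mult_weighted_summable)
    (use assms sum_norm_mu_sq[of x] in \<open>auto simp: Omega_A_iff abs_square_less_1\<close>)

lemma Vq_regular_at_mu_series_mult:
  assumes a: "a \<in> Omega_A" and g: "Vq_regular_at a g" and c: "weighted_summable c"
  shows "Vq_regular_at a (\<lambda>x. \<Sum>\<^sub>\<infinity>\<alpha>. mu_pow \<alpha> x * (g x * c \<alpha>))"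
proof -
  have q: "qvec a \<noteq> 0" and "norm a < 1" using a by (auto simp: Omega_A_iff)
  define m1 where "m1 = norm (mu (qim1 a) a)"
  define m2 where "m2 = norm (mu (qim2 a) a)"
  define m3 where "m3 = norm (mu (qim3 a) a)"
  have nonneg: "0 \<le> m1" "0 \<le> m2" "0 \<le> m3" by (auto simp: m1_def m2_def m3_def)
  have "((\<lambda>e. (m1 + e)\<^sup>2 + (m2 + e)\<^sup>2 + (m3 + e)\<^sup>2) \<longlongrightarrow> (m1 + 0)\<^sup>2 + (m2 + 0)\<^sup>2 + (m3 + 0)\<^sup>2) (at_right 0)"
    by (intro tendsto_intros)
  moreover have "(m1 + 0)\<^sup>2 + (m2 + 0)\<^sup>2 + (m3 + 0)\<^sup>2 < 1"
    using sum_norm_mu_sq[OF q] \<open>norm a < 1\<close> by (simp add: m1_def m2_def m3_def abs_square_less_1)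
  ultimately have "\<forall>\<^sub>F e in at_right 0. (m1 + e)\<^sup>2 + (m2 + e)\<^sup>2 + (m3 + e)\<^sup>2 < 1"
    by (rule order_tendstoD)
  then obtain e where e: "0 < e" "(m1 + e)\<^sup>2 + (m2 + e)\<^sup>2 + (m3 + e)\<^sup>2 < 1"
    by (metis (mono_tags, lifting) dense eventually_at_right_field)
  have shrink: "\<exists>t>0. \<forall>r. 0 < r \<longrightarrow> r \<le> t \<longrightarrow> majorized a r (norm (f a) + e) f" if "Vq_regular_at a f" for f
    using that majorized_shrink[OF _ \<open>0 < e\<close>, of a _ _ f]
    unfolding Vq_regular_at_def analytic_at_majorized by metis
  obtain r1 r2 r3 where r: "0 < r1" "0 < r2" "0 < r3"
    and m: "\<And>r. 0 < r \<Longrightarrow> r \<le> r1 \<Longrightarrow> majorized a r (m1 + e) (\<lambda>x. mu (qim1 x) x)"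
      "\<And>r. 0 < r \<Longrightarrow> r \<le> r2 \<Longrightarrow> majorized a r (m2 + e) (\<lambda>x. mu (qim2 x) x)"
      "\<And>r. 0 < r \<Longrightarrow> r \<le> r3 \<Longrightarrow> majorized a r (m3 + e) (\<lambda>x. mu (qim3 x) x)"
    using shrink[OF Vq_regular_at_mu(1)[OF q]] shrink[OF Vq_regular_at_mu(2)[OF q]]
      shrink[OF Vq_regular_at_mu(3)[OF q]] unfolding m1_def m2_def m3_def by blast
  obtain r4 N where "majorized a r4 N g"
    using g by (auto simp: Vq_regular_at_def analytic_at_majorized)
  define s where "s = min (min r1 r2) (min r3 r4)"
  have s: "0 < s" "s \<le> r1" "s \<le> r2" "s \<le> r3" "s \<le> r4"
    using r majorizedD(1)[OF \<open>majorized a r4 N g\<close>] by (auto simp: s_def)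
  obtain N' where N': "majorized a s N' g"
    using majorized_mono[OF \<open>majorized a r4 N g\<close> s(1,5)] by blast
  have "majorized a s (mpow \<alpha> (m1 + e) (m2 + e) (m3 + e) * (N' * norm (c \<alpha>))) (\<lambda>x. mu_pow \<alpha> x * (g x * c \<alpha>))" for \<alpha>
  proof (cases \<alpha>)
    case (fields a1 a2 a3)
    show ?thesis
      unfolding fields mu_pow.simps mpow.simps
      by (intro majorized_mult majorized_power majorized_const m s N')
  qed
  moreover have "(\<lambda>\<alpha>. mpow \<alpha> (m1 + e) (m2 + e) (m3 + e) * (N' * norm (c \<alpha>))) summable_on UNIV"
    using summable_on_cmult_right[OF mpow_mult_weighted_summable[OF _ _ _ e(2) c], of N'] nonneg e(1)
    by (simp add: mult_ac)
  ultimately show ?thesis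
    by (rule Vq_regular_at_infsum[OF s(1)]) (intro Vq_regular_at_mu_pow_mult Vq_regular_at_mult_const g q)
qed

section \<open>Uniqueness and computation of CK-extensions\<close>

text \<open>For a quaternion \<open>I\<close> with \<open>I\<^sup>2 = -1\<close> the map \<open>\<Phi> p = qre p - \<i> qre (I p)\<close> satisfies
  \<open>\<Phi> (I p) = \<i> \<Phi> p\<close>, and \<open>V\<^sub>q f = 0\<close> is the Cauchy-Riemann equation in the half plane spanned by
  \<open>1\<close> and \<open>I\<close>.  Hence \<open>\<Phi> (f (s + t I) v)\<close> is a holomorphic function of \<open>s + \<i> t\<close>.\<close>

lemma Vq_regular_slice_holomorphic:
  assumes D: "\<And>a. a \<in> Omega_A \<Longrightarrow> Vq_regular_at a D"
    and I: "qre I = 0" "I * I = -1"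
  shows "(\<lambda>z. Complex (qre (D (of_real (Re z) + Im z *\<^sub>R I) * v)) (- qre (I * (D (of_real (Re z) + Im z *\<^sub>R I) * v))))
    holomorphic_on {z. 0 < Im z \<and> norm z < 1}"
proof (rule holomorphic_onI)
  fix z assume "z \<in> {z. 0 < Im z \<and> norm z < 1}"
  then have z: "0 < Im z" "norm z < 1" by auto
  define \<sigma> where "\<sigma> z = of_real (Re z) + Im z *\<^sub>R I" for z
  have "norm I * norm I = norm (-1 :: quat)"
    unfolding I(2)[symmetric] norm_mult ..
  then have "(norm I)\<^sup>2 = 1\<^sup>2"
    by (simp add: power2_eq_square)
  then have nI: "norm I = 1"
    by (rule power2_eq_imp_eq) simp_all
  have q: "qvec (\<sigma> z) = Im z *\<^sub>R I"
    using I(1) by (simp add: \<sigma>_def quat_eq_iff)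
  have "(norm (\<sigma> z))\<^sup>2 = (Re z)\<^sup>2 + (Im z)\<^sup>2 * (norm I)\<^sup>2"
    using I(1) by (simp add: \<sigma>_def quat_norm_square power_mult_distrib algebra_simps)
  then have "(norm (\<sigma> z))\<^sup>2 = (norm z)\<^sup>2"
    by (simp add: nI cmod_power2)
  then have "norm (\<sigma> z) = norm z"
    by simp
  moreover have "I \<noteq> 0" using nI by auto
  ultimately have "\<sigma> z \<in> Omega_A"
    using z q by (simp add: Omega_A_iff)
  then obtain D' where D': "(D has_derivative D') (at (\<sigma> z))"
    and V: "D' 1 = inverse (qvec (\<sigma> z)) * D' (qvec (\<sigma> z))"
    using Vq_regular_at_derivative D by metis
  interpret D': bounded_linear D' using D' by (rule has_derivative_bounded_linear)
  have invI: "inverse I = - I"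
    using inverse_unique[of I "- I"] I(2) by simp
  have "D' 1 = - (I * D' I)"
    unfolding V q using z by (simp add: D'.scaleR inverse_scaleR_distrib invI)
  then have CR: "D' I = I * D' 1"
    using I(2) by (simp add: mult.assoc[symmetric])
  have "(\<sigma> has_derivative \<sigma>) (at z)"
    unfolding \<sigma>_def of_real_def by (auto intro!: derivative_eq_intros)
  from has_derivative_compose[OF this D'] have "((\<lambda>z. D (\<sigma> z) * v) has_derivative (\<lambda>h. D' (\<sigma> h) * v)) (at z)"
    by (rule has_derivative_mult_left)
  then have *: "((\<lambda>z. Complex (qre (D (\<sigma> z) * v)) (- qre (I * (D (\<sigma> z) * v)))) has_derivative
     (\<lambda>h. Complex (qre (D' (\<sigma> h) * v)) (- qre (I * (D' (\<sigma> h) * v))))) (at z)"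
  proof (rule has_derivative_compose[where f="\<lambda>z. D (\<sigma> z) * v" and g="\<lambda>p. Complex (qre p) (- qre (I * p))"])
    have "bounded_linear (\<lambda>p. Complex (qre p) (- qre (I * p)))"
      by (rule linear_conv_bounded_linear[THEN iffD1], rule linearI) (simp_all add: complex_eq_iff algebra_simps)
    then show "((\<lambda>p. Complex (qre p) (- qre (I * p))) has_derivative (\<lambda>p. Complex (qre p) (- qre (I * p))))
        (at (D (\<sigma> z) * v))"
      by (rule bounded_linear_imp_has_derivative)
  qed
  have Dh: "D' (\<sigma> h) = (of_real (Re h) + Im h *\<^sub>R I) * D' 1" for h
    by (simp add: \<sigma>_def D'.add D'.scaleR of_real_def CR distrib_right)
  have I3: "I * (I * p) = - p" for p
    using I(2) by (simp add: mult.assoc[symmetric])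
  have I2: "I * ((of_real r + s *\<^sub>R I) * p) = r *\<^sub>R (I * p) - s *\<^sub>R p" for r s p
    using I(2) by (simp add: of_real_def distrib_left distrib_right mult.assoc[symmetric])
  have I1: "(of_real r + s *\<^sub>R I) * p = r *\<^sub>R p + s *\<^sub>R (I * p)" for r s p
    by (simp add: of_real_def distrib_right)
  have "(\<lambda>h. Complex (qre (D' (\<sigma> h) * v)) (- qre (I * (D' (\<sigma> h) * v)))) =
      (*) (Complex (qre (D' 1 * v)) (- qre (I * (D' 1 * v))))"
    unfolding Dh mult.assoc I2 I1 by (auto simp: I3 fun_eq_iff complex_eq_iff algebra_simps simp del: quat_mult_simps)
  with * have "((\<lambda>z. Complex (qre (D (\<sigma> z) * v)) (- qre (I * (D (\<sigma> z) * v)))) has_field_derivative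
      Complex (qre (D' 1 * v)) (- qre (I * (D' 1 * v)))) (at z)"
    by (simp add: has_field_derivative_def)
  then show "(\<lambda>z. Complex (qre (D (of_real (Re z) + Im z *\<^sub>R I) * v)) (- qre (I * (D (of_real (Re z) + Im z *\<^sub>R I) * v))))
      field_differentiable at z within {z. 0 < Im z \<and> cmod z < 1}"
    unfolding \<sigma>_def by (auto simp: field_differentiable_def intro: has_field_derivative_at_within)
qed

lemma Vq_regular_eq_0:
  assumes D: "\<And>a. a \<in> Omega_A \<Longrightarrow> Vq_regular_at a D"
    and zero: "\<And>a. a \<in> Omega_A \<Longrightarrow> qre a = 0 \<Longrightarrow> D a = 0"
    and x: "x \<in> Omega_A"
  shows "D x = 0"
proof -
  let ?r = "norm (qvec x)"
  define I where "I = qvec x /\<^sub>R ?r"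
  have r: "0 < ?r" and nx: "norm x < 1" using x by (auto simp: Omega_A_iff)
  have nI: "norm I = 1" and I0: "qre I = 0"
    using r by (simp_all add: I_def)
  have qI: "qcnj I = - I"
    using I0 by (simp add: qcnj_def quat_eq_iff)
  have I2: "I * I = -1"
    using quat_mult_cnj(1)[of I] by (simp add: qI nI) (metis minus_minus)
  have x_eq: "x = of_real (qre x) + ?r *\<^sub>R I"
    using r by (simp add: I_def quat_eq_iff)
  let ?H = "{z. 0 < Im z \<and> cmod z < 1}"
  have "open ?H"
    by (intro open_Collect_conj open_Collect_less continuous_intros)
  have "convex ?H"
    using convex_Int[OF convex_halfspace_Im_gt[of 0] convex_ball[of "0::complex" 1]]
    by (simp add: Int_def ball_def)
  have "qre (D x * v) = 0" for v
  proof -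
    let ?g = "\<lambda>z. Complex (qre (D (of_real (Re z) + Im z *\<^sub>R I) * v)) (- qre (I * (D (of_real (Re z) + Im z *\<^sub>R I) * v)))"
    let ?U = "(\<lambda>t. \<i> * of_real t) ` {0<..<1}"
    have "?g (Complex (qre x) ?r) = 0"
    proof (rule analytic_continuation[OF Vq_regular_slice_holomorphic[OF D I0 I2] \<open>open ?H\<close>])
      show "connected ?H" using \<open>convex ?H\<close> by (rule convex_connected)
      show "?U \<subseteq> ?H" by (auto simp: norm_mult)
      show "\<i> * of_real (1 / 2) \<in> ?H" by (simp add: norm_mult)
      show "\<i> * of_real (1 / 2) islimpt ?U"
      proof (rule islimptI)
        fix T :: "complex set" assume T: "\<i> * of_real (1 / 2) \<in> T" "open T"
        have "((\<lambda>t. \<i> * of_real t) \<longlongrightarrow> \<i> * of_real (1 / 2)) (at_right (1 / 2 :: real))"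
          by (intro tendsto_intros)
        then have "\<forall>\<^sub>F t in at_right (1 / 2). \<i> * of_real t \<in> T"
          using T(2,1) by (rule topological_tendstoD)
        moreover have "\<forall>\<^sub>F t :: real in at_right (1 / 2). t < 1 \<and> 1 / 2 < t"
          by (intro eventually_conj eventually_at_right_less eventually_at_rightI[of _ 1]) auto
        ultimately obtain t :: real where "\<i> * of_real t \<in> T" "t < 1" "1 / 2 < t"
          by (metis (mono_tags, lifting) eventually_conj eventually_happens trivial_limit_at_right_real)
        then show "\<exists>y\<in>?U. y \<in> T \<and> y \<noteq> \<i> * of_real (1 / 2)"
          by (intro bexI[of _ "\<i> * of_real t"]) (auto simp del: of_real_divide)
      qed
      show "?g z = 0" if "z \<in> ?U" for z
      proof -
        from that obtain t where t: "z = \<i> * of_real t" "0 < t" "t < 1" by auto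
        have "qvec (t *\<^sub>R I) = t *\<^sub>R I" using I0 by (simp add: quat_eq_iff)
        then have "t *\<^sub>R I \<in> Omega_A"
          using t nI by (auto simp: Omega_A_iff)
        then have "D (t *\<^sub>R I) = 0"
          using zero I0 by simp
        then show ?thesis by (simp add: t zero_complex.code)
      qed
      have "(cmod (Complex (qre x) ?r))\<^sup>2 = (norm x)\<^sup>2"
        using quat_norm_square[of "qvec x"] by (simp add: cmod_power2 quat_norm_square[of x])
      then have "cmod (Complex (qre x) ?r) = norm x"
        by (rule power2_eq_imp_eq) simp_all
      with r nx show "Complex (qre x) ?r \<in> ?H" by simp
    qed
    then show ?thesis
      using x_eq by (simp add: complex_eq_iff)
  qed
  from this[of 1] this[of e1] this[of e2] this[of e3] show ?thesis
    by (simp add: quat_eq_iff e1_def e2_def e3_def)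
qed

lemma CK_Vq_eq:
  assumes F: "\<And>a. a \<in> Omega_A \<Longrightarrow> Vq_regular_at a F"
    and h: "\<And>x1 x2 x3. Quat 0 x1 x2 x3 \<in> Omega_A \<Longrightarrow> F (Quat 0 x1 x2 x3) = h x1 x2 x3"
    and x: "x \<in> Omega_A"
  shows "CK_Vq Omega_A h x = F x"
proof -
  define F' where "F' x = (if x \<in> Omega_A then F x else 0)" for x
  have "CK_Vq Omega_A h = F'"
    unfolding CK_Vq_def
  proof (rule the_equality)
    have "Vq_regular_at a F'" if "a \<in> Omega_A" for a
      by (rule Vq_regular_at_cong[OF open_Omega_A that _ F[OF that]]) (simp add: F'_def)
    then show F': "Vq_regular_on F' Omega_A \<and>
        (\<forall>x1 x2 x3. Quat 0 x1 x2 x3 \<in> Omega_A \<longrightarrow> F' (Quat 0 x1 x2 x3) = h x1 x2 x3) \<and>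
        (\<forall>x. x \<notin> Omega_A \<longrightarrow> F' x = 0)"
      using h by (simp add: F'_def Vq_regular_on_iff[OF open_Omega_A])
    fix G assume G: "Vq_regular_on G Omega_A \<and>
        (\<forall>x1 x2 x3. Quat 0 x1 x2 x3 \<in> Omega_A \<longrightarrow> G (Quat 0 x1 x2 x3) = h x1 x2 x3) \<and>
        (\<forall>x. x \<notin> Omega_A \<longrightarrow> G x = 0)"
    have "G y + F' y * (-1) = 0" if "y \<in> Omega_A" for y
    proof (rule Vq_regular_eq_0[where D="\<lambda>y. G y + F' y * (-1)", OF _ _ that])
      show "Vq_regular_at a (\<lambda>y. G y + F' y * (-1))" if "a \<in> Omega_A" for a
        using G F' that by (intro Vq_regular_at_add Vq_regular_at_mult_const)
          (auto simp: Vq_regular_on_iff[OF open_Omega_A])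
      show "G a + F' a * (-1) = 0" if "a \<in> Omega_A" "qre a = 0" for a
        using G F' that by (cases a) simp
    qed
    then show "G = F'"
      using G by (auto simp: fun_eq_iff F'_def)
  qed
  with x show ?thesis by (simp add: F'_def)
qed

lemma CK_scalmat_mu_pow:
  assumes S: "\<And>i j. Vq_regular_on (\<lambda>x. S x $ i $ j) Omega_A" and x: "x \<in> Omega_A"
  shows "CK_scalmat Omega_A (mu_pow \<alpha>) S x = (\<chi> i j. mu_pow \<alpha> x * S x $ i $ j)"
proof -
  have "CK_Vq Omega_A (\<lambda>x1 x2 x3. mu_pow \<alpha> (Quat 0 x1 x2 x3) * S (Quat 0 x1 x2 x3) $ i $ j) x =
      mu_pow \<alpha> x * S x $ i $ j" for i j
    by (rule CK_Vq_eq[OF _ _ x])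
      (use S in \<open>auto simp: Vq_regular_on_iff[OF open_Omega_A] Omega_A_iff intro!: Vq_regular_at_mu_pow_mult\<close>)
  then show ?thesis
    by (simp add: CK_scalmat_def vec_eq_iff)
qed

lemma CK_matvec_mu_series:
  assumes S: "\<And>i j. Vq_regular_on (\<lambda>x. S x $ i $ j) Omega_A" and x: "x \<in> Omega_A"
    and f: "\<And>j. mu_series (\<lambda>x. f x $ j) (c j)" and c: "\<And>j. weighted_summable (c j)"
  shows "CK_matvec Omega_A S f x $ i = (\<Sum>j\<in>UNIV. \<Sum>\<^sub>\<infinity>\<alpha>. mu_pow \<alpha> x * (S x $ i $ j * c j \<alpha>))"
proof -
  have "CK_Vq Omega_A (\<lambda>x1 x2 x3. (S (Quat 0 x1 x2 x3) *v f (Quat 0 x1 x2 x3)) $ i) x =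
      (\<Sum>j\<in>UNIV. \<Sum>\<^sub>\<infinity>\<alpha>. mu_pow \<alpha> x * (S x $ i $ j * c j \<alpha>))"
  proof (rule CK_Vq_eq[where F="\<lambda>x. \<Sum>j\<in>UNIV. \<Sum>\<^sub>\<infinity>\<alpha>. mu_pow \<alpha> x * (S x $ i $ j * c j \<alpha>)", OF _ _ x])
    show "Vq_regular_at a (\<lambda>x. \<Sum>j\<in>UNIV. \<Sum>\<^sub>\<infinity>\<alpha>. mu_pow \<alpha> x * (S x $ i $ j * c j \<alpha>))" if "a \<in> Omega_A" for a
      using S that c by (intro Vq_regular_at_sum Vq_regular_at_mu_series_mult)
        (auto simp: Vq_regular_on_iff[OF open_Omega_A])
    fix x1 x2 x3 assume y: "Quat 0 x1 x2 x3 \<in> Omega_A"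
    let ?y = "Quat 0 x1 x2 x3"
    have "(\<Sum>\<^sub>\<infinity>\<alpha>. mu_pow \<alpha> ?y * (S ?y $ i $ j * c j \<alpha>)) = S ?y $ i $ j * f ?y $ j" for j
    proof (rule infsumI)
      have "((\<lambda>\<alpha>. mu_pow \<alpha> ?y * c j \<alpha>) has_sum f ?y $ j) UNIV"
        using f y by (simp add: mu_series_def)
      from has_sum_bounded_linear[OF bounded_linear_mult_right this, of "S ?y $ i $ j"]
      show "((\<lambda>\<alpha>. mu_pow \<alpha> ?y * (S ?y $ i $ j * c j \<alpha>)) has_sum S ?y $ i $ j * f ?y $ j) UNIV"
      proof (rule has_sum_cong[THEN iffD1, rotated])
        show "S ?y $ i $ j * (mu_pow \<alpha> ?y * c j \<alpha>) = mu_pow \<alpha> ?y * (S ?y $ i $ j * c j \<alpha>)" for \<alpha>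
          by (cases \<alpha>) (simp add: mu_pow_purely_vectorial scaleR_conv_of_real[symmetric] del: mu_pow.simps of_real_mult of_real_power)
      qed
    qed
    then show "(\<Sum>j\<in>UNIV. \<Sum>\<^sub>\<infinity>\<alpha>. mu_pow \<alpha> ?y * (S ?y $ i $ j * c j \<alpha>)) = (S ?y *v f ?y) $ i"
      by (simp add: matrix_vector_mult_def)
  qed
  then show ?thesis
    by (simp add: CK_matvec_def)
qed

section \<open>Uniqueness of the coefficients\<close>

lemma power_series_vanishing_imp_coeff_0:
  fixes d :: "nat \<Rightarrow> 'a::euclidean_space"
  assumes "0 < r" and zero: "\<And>t. 0 < t \<Longrightarrow> t < r \<Longrightarrow> ((\<lambda>k. t ^ k *\<^sub>R d k) has_sum 0) UNIV"
  shows "d n = 0"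
proof (induction n rule: less_induct)
  case (less n)
  define t0 where "t0 = r / 2"
  have t0: "0 < t0" "t0 < r" using \<open>0 < r\<close> by (auto simp: t0_def)
  have "(\<lambda>k. norm (t0 ^ k *\<^sub>R d k)) summable_on UNIV"
    by (intro summable_on_imp_abs_summable_on_euclidean has_sum_imp_summable[OF zero[OF t0]])
  then obtain C where C: "((\<lambda>k. norm (t0 ^ k *\<^sub>R d k)) has_sum C) UNIV"
    by (auto simp: summable_on_def)
  have le: "norm (d n) \<le> t * (C / t0 ^ Suc n)" if t: "0 < t" "t < t0" for t
  proof -
    have "((\<lambda>k. if k = n then - (t ^ n *\<^sub>R d n) else 0) has_sum (\<Sum>k\<in>{n}. if k = n then - (t ^ n *\<^sub>R d n) else 0)) UNIV"
      by (rule has_sum_finite_neutralI[where B="{n}"]) auto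
    then have "((\<lambda>k. t ^ k *\<^sub>R d k + (if k = n then - (t ^ n *\<^sub>R d n) else 0)) has_sum 0 + - (t ^ n *\<^sub>R d n)) UNIV"
      using zero[of t] t t0 by (intro has_sum_add) auto
    then have "norm (0 + - (t ^ n *\<^sub>R d n)) \<le> (t / t0) ^ Suc n * C"
    proof (rule norm_infsum_le[OF _ has_sum_cmult_right[OF C]])
      fix k
      show "norm (t ^ k *\<^sub>R d k + (if k = n then - (t ^ n *\<^sub>R d n) else 0)) \<le> (t / t0) ^ Suc n * norm (t0 ^ k *\<^sub>R d k)"
      proof (cases "k \<le> n")
        case True
        then have "t ^ k *\<^sub>R d k + (if k = n then - (t ^ n *\<^sub>R d n) else 0) = 0"
          using less[of k] by auto
        then show ?thesis using t t0 by simp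
      next
        case False
        have "(t / t0) ^ k \<le> (t / t0) ^ Suc n"
          using False t t0 by (intro power_decreasing) auto
        then have "(t / t0) ^ k * (t0 ^ k * norm (d k)) \<le> (t / t0) ^ Suc n * (t0 ^ k * norm (d k))"
          using t0 by (intro mult_right_mono) auto
        then show ?thesis
          using False t t0 by (simp add: power_divide)
      qed
    qed
    then have "t ^ n * norm (d n) \<le> t ^ n * (t * (C / t0 ^ Suc n))"
      using t t0 by (simp add: power_divide mult_ac)
    then show ?thesis
      using t by (simp only: mult_le_cancel_left_pos zero_less_power)
  qed
  have "norm (d n) \<le> 0 * (C / t0 ^ Suc n)"
  proof (rule tendsto_le[OF trivial_limit_at_right_real _ tendsto_const])
    show "((\<lambda>t. t * (C / t0 ^ Suc n)) \<longlongrightarrow> 0 * (C / t0 ^ Suc n)) (at_right 0)"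
      by (intro tendsto_intros)
    show "\<forall>\<^sub>F t in at_right 0. norm (d n) \<le> t * (C / t0 ^ Suc n)"
      using t0 le by (intro eventually_at_rightI[of 0 t0]) auto
  qed
  then show ?case by simp
qed

lemma power_series_vanishing_imp_slice_0:
  fixes e :: "nat \<times> 'b \<Rightarrow> 'a::euclidean_space"
  assumes "0 < r" and zero: "\<And>t. 0 < t \<Longrightarrow> t < r \<Longrightarrow> ((\<lambda>(k, b). t ^ k *\<^sub>R e (k, b)) has_sum 0) UNIV"
  shows "((\<lambda>b. e (n, b)) has_sum 0) UNIV"
proof -
  have summ: "(\<lambda>b. e (k, b)) summable_on UNIV" for k
  proof -
    have "(\<lambda>(k, b). (r / 2) ^ k *\<^sub>R e (k, b)) summable_on Pair k ` UNIV"
      by (rule summable_on_subset_banach[OF has_sum_imp_summable[OF zero]]) (use \<open>0 < r\<close> in auto)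
    then have "(\<lambda>b. (r / 2) ^ k *\<^sub>R e (k, b)) summable_on UNIV"
      by (subst (asm) summable_on_reindex) (auto simp: inj_on_def o_def)
    then have "(\<lambda>b. inverse ((r / 2) ^ k) *\<^sub>R ((r / 2) ^ k *\<^sub>R e (k, b))) summable_on UNIV"
      by (rule summable_on_scaleR_right)
    then show ?thesis
      using \<open>0 < r\<close> by simp
  qed
  have "(\<Sum>\<^sub>\<infinity>b. e (n, b)) = 0"
  proof (rule power_series_vanishing_imp_coeff_0[OF \<open>0 < r\<close>])
    fix t :: real assume t: "0 < t" "t < r"
    have "((\<lambda>(k, b). t ^ k *\<^sub>R e (k, b)) has_sum 0) (Sigma UNIV (\<lambda>_. UNIV))"
      using zero[OF t] by simp
    then show "((\<lambda>k. t ^ k *\<^sub>R (\<Sum>\<^sub>\<infinity>b. e (k, b))) has_sum 0) UNIV"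
      by (rule has_sum_SigmaD) (auto intro!: has_sum_scaleR has_sum_infsum summ)
  qed
  then show ?thesis
    using has_sum_infsum[OF summ, of n] by simp
qed

lemma mu_series_unique:
  assumes "mu_series f c" "mu_series f d"
  shows "c = d"
proof
  fix \<alpha> :: midx
  define e where "e \<alpha> = c \<alpha> + - d \<alpha>" for \<alpha>
  have e: "((\<lambda>(a1, a2, a3). x1 ^ a1 *\<^sub>R (x2 ^ a2 *\<^sub>R (x3 ^ a3 *\<^sub>R e (a1, a2, a3)))) has_sum 0) UNIV"
    if x: "0 < x1" "x1 < 1/2" "0 < x2" "x2 < 1/2" "0 < x3" "x3 < 1/2" for x1 x2 x3 :: real
  proof -
    let ?x = "Quat 0 x1 x2 x3"
    have "x1\<^sup>2 \<le> (1/2)\<^sup>2" "x2\<^sup>2 \<le> (1/2)\<^sup>2" "x3\<^sup>2 \<le> (1/2)\<^sup>2"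
      using x by (auto intro!: power_mono simp del: power_one_over)
    moreover have "(1/2)\<^sup>2 = (1/4 :: real)"
      by (simp add: power2_eq_square)
    ultimately have "(norm ?x)\<^sup>2 < 1"
      unfolding quat_norm_square by simp
    then have "?x \<in> Omega_A"
      using x by (simp add: Omega_A_iff abs_square_less_1 quat_eq_iff)
    then have "((\<lambda>\<alpha>. mu_pow \<alpha> ?x * c \<alpha> + - (mu_pow \<alpha> ?x * d \<alpha>)) has_sum f ?x + - f ?x) UNIV"
      using assms by (intro has_sum_add has_sum_uminusI) (auto simp: mu_series_def)
    then have "((\<lambda>\<alpha>. mu_pow \<alpha> ?x * e \<alpha>) has_sum 0) UNIV"
      by (simp add: e_def distrib_left algebra_simps)
    then show ?thesis
    proof (rule has_sum_cong[THEN iffD1, rotated])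
      show "mu_pow \<alpha> ?x * e \<alpha> =
          (case \<alpha> of (a1, a2, a3) \<Rightarrow> x1 ^ a1 *\<^sub>R (x2 ^ a2 *\<^sub>R (x3 ^ a3 *\<^sub>R e (a1, a2, a3))))" for \<alpha>
        by (cases \<alpha>) (simp add: mu_pow_purely_vectorial scaleR_conv_of_real mult.assoc del: mu_pow.simps)
    qed
  qed
  obtain a1 a2 a3 where \<alpha>: "\<alpha> = (a1, a2, a3)" by (cases \<alpha>)
  have "((\<lambda>(a2, a3). x2 ^ a2 *\<^sub>R (x3 ^ a3 *\<^sub>R e (a1, a2, a3))) has_sum 0) UNIV"
    if "0 < x2" "x2 < 1/2" "0 < x3" "x3 < 1/2" for x2 x3 :: real
    using power_series_vanishing_imp_slice_0[of "1/2" "\<lambda>(a1, a2, a3). x2 ^ a2 *\<^sub>R (x3 ^ a3 *\<^sub>R e (a1, a2, a3))" a1]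
      e that by (simp add: case_prod_unfold)
  then have "((\<lambda>a3. x3 ^ a3 *\<^sub>R e (a1, a2, a3)) has_sum 0) UNIV" if "0 < x3" "x3 < 1/2" for x3 :: real
    using power_series_vanishing_imp_slice_0[of "1/2" "\<lambda>(a2, a3). x3 ^ a3 *\<^sub>R e (a1, a2, a3)" a2]
      that by (simp add: case_prod_unfold)
  then have "e (a1, a2, a3) = 0"
    by (intro power_series_vanishing_imp_coeff_0[of "1/2" "\<lambda>a3. e (a1, a2, a3)"]) auto
  then show "c \<alpha> = d \<alpha>"
    by (simp add: \<alpha> e_def)
qed

lemma arveson_coeff_eq: "mu_series f c \<Longrightarrow> arveson_coeff f = c"
  unfolding arveson_coeff_def by (rule the_equality) (auto intro: mu_series_unique)


section \<open>The Arveson space as a space of square-summable families\<close>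

lemma has_sum_finite_prod:
  fixes F :: "'n::finite \<times> 'k \<Rightarrow> 'a::topological_comm_monoid_add"
  assumes "\<And>i. ((\<lambda>k. F (i, k)) has_sum S i) UNIV"
  shows "(F has_sum (\<Sum>i\<in>UNIV. S i)) UNIV"
proof -
  have "((\<lambda>p. if fst p = i then F p else 0) has_sum S i) UNIV" for i
  proof -
    have "(F has_sum S i) (Pair i ` UNIV)"
      using assms[of i] by (subst has_sum_reindex) (auto simp: inj_on_def o_def)
    then show ?thesis
      by (rule has_sum_cong_neutral[THEN iffD1, rotated -1]) auto
  qed
  then have "((\<lambda>p. \<Sum>i\<in>UNIV. if fst p = i then F p else 0) has_sum (\<Sum>i\<in>UNIV. S i)) UNIV"
    by (intro has_sum_sum) auto
  then show ?thesis by simp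
qed

definition ell2_coeff :: "('n \<times> midx, quat) ell2 \<Rightarrow> 'n \<Rightarrow> midx \<Rightarrow> quat" where
  "ell2_coeff u i \<alpha> = sqrt (multinom \<alpha>) *\<^sub>R coord u (i, \<alpha>)"

lemma norm_ell2_coeff_sq: "(norm (ell2_coeff u i \<alpha>))\<^sup>2 / multinom \<alpha> = (norm (coord u (i, \<alpha>)))\<^sup>2"
  using multinom_pos[of \<alpha>] by (simp add: ell2_coeff_def power_mult_distrib)

lemma weighted_summable_ell2_coeff: "weighted_summable (ell2_coeff u i)"
proof -
  have "(\<lambda>p. (norm (coord u p))\<^sup>2) summable_on (Pair i ` UNIV)"
    using square_summable_coord[of u] unfolding square_summable_def by (rule summable_on_subset) simp
  then have "(\<lambda>\<alpha>. (norm (coord u (i, \<alpha>)))\<^sup>2) summable_on UNIV"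
    by (subst (asm) summable_on_reindex) (auto simp: inj_on_def o_def)
  then show ?thesis
    by (simp add: weighted_summable_def norm_ell2_coeff_sq)
qed

lemma norm_ell2_eq_sum:
  fixes u :: "('n::finite \<times> midx, quat) ell2"
  shows "(norm u)\<^sup>2 = (\<Sum>i\<in>UNIV. \<Sum>\<^sub>\<infinity>\<alpha>. (norm (ell2_coeff u i \<alpha>))\<^sup>2 / multinom \<alpha>)"
  unfolding norm_ell2_eq norm_ell2_coeff_sq
  by (intro infsumI has_sum_finite_prod has_sum_infsum)
    (use weighted_summable_ell2_coeff[of u] in \<open>simp add: weighted_summable_def norm_ell2_coeff_sq\<close>)

lemma ell2_coeff_surj:
  fixes c :: "'n::finite \<Rightarrow> midx \<Rightarrow> quat"
  assumes "\<And>i. weighted_summable (c i)"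
  obtains u where "ell2_coeff u = c"
proof
  let ?g = "\<lambda>(i, \<alpha>). (1 / sqrt (multinom \<alpha>)) *\<^sub>R c i \<alpha>"
  have "((\<lambda>p. (norm (?g p))\<^sup>2) has_sum (\<Sum>i\<in>UNIV. \<Sum>\<^sub>\<infinity>\<alpha>. (norm (?g (i, \<alpha>)))\<^sup>2)) UNIV"
    using assms by (intro has_sum_finite_prod has_sum_infsum)
      (simp add: square_summable_iff_weighted_summable[symmetric] square_summable_def)
  then have "square_summable ?g"
    by (auto simp: square_summable_def intro: has_sum_imp_summable)
  then show "ell2_coeff (Abs_ell2 ?g) = c"
    using multinom_pos by (auto simp: fun_eq_iff ell2_coeff_def Abs_ell2_inverse less_imp_neq[symmetric])
qed

lemma mu_series_infsum:
  assumes "weighted_summable c"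
  shows "mu_series (\<lambda>x. \<Sum>\<^sub>\<infinity>\<alpha>. mu_pow \<alpha> x * c \<alpha>) c"
  unfolding mu_series_def
proof
  fix x assume "x \<in> Omega_A"
  then have "(\<lambda>\<alpha>. mu_pow \<alpha> x * c \<alpha>) summable_on UNIV"
    using mu_pow_mult_abs_summable[OF _ assms] by (simp add: norm_mult abs_summable_summable)
  then show "((\<lambda>\<alpha>. mu_pow \<alpha> x * c \<alpha>) has_sum (\<Sum>\<^sub>\<infinity>\<alpha>. mu_pow \<alpha> x * c \<alpha>)) UNIV"
    by (rule has_sum_infsum)
qed

lemma arveson_vec_iff:
  fixes f :: "quat \<Rightarrow> quat ^ 'n"
  shows "f \<in> arveson_vec \<longleftrightarrow> (\<exists>u. \<forall>i. mu_series (\<lambda>x. f x $ i) (ell2_coeff u i))"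
proof
  assume "f \<in> arveson_vec"
  then have "\<forall>i. \<exists>c. mu_series (\<lambda>x. f x $ i) c \<and> weighted_summable c"
    by (simp add: arveson_vec_def arveson_def weighted_summable_def)
  then obtain c where c: "\<And>i. mu_series (\<lambda>x. f x $ i) (c i)" "\<And>i. weighted_summable (c i)"
    by metis
  obtain u where "ell2_coeff u = c"
    by (rule ell2_coeff_surj[of c, OF c(2)])
  with c(1) show "\<exists>u. \<forall>i. mu_series (\<lambda>x. f x $ i) (ell2_coeff u i)"
    by auto
next
  assume "\<exists>u. \<forall>i. mu_series (\<lambda>x. f x $ i) (ell2_coeff u i)"
  then obtain u where "mu_series (\<lambda>x. f x $ i) (ell2_coeff u i)" for i
    by blast
  then show "f \<in> arveson_vec"
    unfolding arveson_vec_def arveson_def weighted_summable_def[symmetric]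
    using weighted_summable_ell2_coeff by (intro CollectI allI exI conjI)
qed

lemma arveson_vec_norm_eq:
  fixes f :: "quat \<Rightarrow> quat ^ 'n"
  assumes "\<And>i. mu_series (\<lambda>x. f x $ i) (ell2_coeff u i)"
  shows "arveson_vec_norm f = norm u"
proof -
  have "(\<Sum>i\<in>UNIV. (arveson_norm (\<lambda>x. f x $ i))\<^sup>2) = (norm u)\<^sup>2"
    unfolding norm_ell2_eq_sum arveson_norm_def arveson_coeff_eq[OF assms]
    by (intro sum.cong refl real_sqrt_pow2 infsum_nonneg) (simp add: multinom_pos less_imp_le)
  then show ?thesis
    by (simp add: arveson_vec_norm_def)
qed

section \<open>Kernel vectors and Gram matrices\<close>

lemma qcnj_simps [simp]:
  "qre (qcnj x) = qre x" "qim1 (qcnj x) = - qim1 x" "qim2 (qcnj x) = - qim2 x" "qim3 (qcnj x) = - qim3 x"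
  by (simp_all add: qcnj_def)

lemma qcnj_mult: "qcnj (x * y) = qcnj y * qcnj x"
  by (simp add: quat_eq_iff algebra_simps)

lemma qcnj_qcnj [simp]: "qcnj (qcnj x) = x"
  by (simp add: quat_eq_iff)

lemma qcnj_0_1 [simp]: "qcnj 0 = 0" "qcnj 1 = 1"
  by (simp_all add: quat_eq_iff)

lemma bounded_linear_qcnj: "bounded_linear qcnj"
  by (rule linear_conv_bounded_linear[THEN iffD1], rule linearI) (simp_all add: quat_eq_iff)

lemmas qcnj_sum = linear_sum[OF bounded_linear.linear[OF bounded_linear_qcnj]]

lemma norm_qcnj [simp]: "norm (qcnj x) = norm x"
  by (rule power2_eq_imp_eq) (simp_all add: quat_norm_square)

lemma inner_mult_qcnj: "inner a (qcnj m * b) = inner (m * a) b"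
  by (simp add: inner_quat_def algebra_simps)

definition scal_mat :: "quat \<Rightarrow> quat ^ 'm ^ 'n \<Rightarrow> quat ^ 'm ^ 'n" where
  "scal_mat m A = (\<chi> i j. m * A $ i $ j)"

lemma scal_mat_mult_ctranspose:
  "(scal_mat p A ** ctranspose (scal_mat q B)) $ i $ j = p * (\<Sum>k\<in>UNIV. A $ i $ k * qcnj (B $ j $ k)) * qcnj q"
  by (simp add: matrix_matrix_mult_def scal_mat_def ctranspose_def qcnj_mult sum_distrib_left sum_distrib_right mult.assoc)

lemma mat_mult_qcnj:
  "(mat (p * qcnj q) :: quat ^ 'n ^ 'n) = scal_mat p (mat 1 :: quat ^ 'n ^ 'n) ** ctranspose (scal_mat q (mat 1))"
proof -
  have mat_1: "mat 1 $ i $ k * z = (if i = k then z else 0)" for i k :: 'n and z :: quat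
    by (simp add: mat_def)
  have "(\<Sum>k\<in>UNIV. mat 1 $ i $ k * qcnj (mat 1 $ j $ k)) = qcnj (mat 1 $ j $ i)" for i j :: 'n
    unfolding mat_1 by simp
  then show ?thesis
    by (simp add: vec_eq_iff scal_mat_mult_ctranspose) (simp add: mat_def)
qed

lemma ctranspose_scal_mat_vector:
  "(ctranspose (scal_mat m A) *v \<xi>) $ j = (\<Sum>i\<in>UNIV. qcnj (A $ i $ j) * (qcnj m * \<xi> $ i))"
  by (simp add: matrix_vector_mult_def ctranspose_def scal_mat_def qcnj_mult mult.assoc)

lemma sesq_form_mult_ctranspose:
  "sesq_form \<xi> (T ** ctranspose T') \<eta> =
    (\<Sum>j\<in>UNIV. qcnj ((ctranspose T *v \<xi>) $ j) * (ctranspose T' *v \<eta>) $ j)"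
proof -
  have "(T *v y) $ a = (\<Sum>j\<in>UNIV. T $ a $ j * y $ j)" for y a
    by (simp add: matrix_vector_mult_def)
  moreover have T: "(ctranspose T *v \<xi>) $ j = (\<Sum>a\<in>UNIV. qcnj (T $ a $ j) * \<xi> $ a)" for j
    by (simp add: matrix_vector_mult_def ctranspose_def)
  ultimately have "sesq_form \<xi> (T ** ctranspose T') \<eta> =
      (\<Sum>a\<in>UNIV. \<Sum>j\<in>UNIV. qcnj (\<xi> $ a) * (T $ a $ j * (ctranspose T' *v \<eta>) $ j))"
    by (simp add: sesq_form_def matrix_vector_mul_assoc[symmetric] sum_distrib_left)
  also have "\<dots> = (\<Sum>j\<in>UNIV. \<Sum>a\<in>UNIV. qcnj (\<xi> $ a) * (T $ a $ j * (ctranspose T' *v \<eta>) $ j))"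
    by (rule sum.swap)
  also have "\<dots> = (\<Sum>j\<in>UNIV. qcnj ((ctranspose T *v \<xi>) $ j) * (ctranspose T' *v \<eta>) $ j)"
    by (simp add: T qcnj_sum qcnj_mult sum_distrib_right mult.assoc)
  finally show ?thesis .
qed

lemma bounded_linear_sesq_form: "bounded_linear (\<lambda>A. sesq_form \<xi> A \<eta>)"
  by (rule linear_conv_bounded_linear[THEN iffD1], rule linearI)
    (simp_all add: sesq_form_def matrix_vector_mult_def sum.distrib distrib_left distrib_right
      scaleR_sum_right sum_distrib_left)

definition kernel_coord :: "quat ^ 'm ^ 'n \<Rightarrow> quat \<Rightarrow> quat ^ 'n \<Rightarrow> 'm \<times> midx \<Rightarrow> quat" where
  "kernel_coord A x \<xi> = (\<lambda>(j, \<alpha>). sqrt (multinom \<alpha>) *\<^sub>R (ctranspose (scal_mat (mu_pow \<alpha> x) A) *v \<xi>) $ j)"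

definition kernel_vec :: "quat ^ 'm ^ 'n \<Rightarrow> quat \<Rightarrow> quat ^ 'n \<Rightarrow> ('m \<times> midx, quat) ell2" where
  "kernel_vec A x \<xi> = Abs_ell2 (kernel_coord A x \<xi>)"

lemma mu_pow_mult_summable:
  assumes "x \<in> Omega_A" "y \<in> Omega_A"
  shows "(\<lambda>\<alpha>. multinom \<alpha> * (norm (mu_pow \<alpha> x) * norm (mu_pow \<alpha> y))) summable_on UNIV"
proof -
  have *: "square_summable (\<lambda>\<alpha>. sqrt (multinom \<alpha>) *\<^sub>R mu_pow \<alpha> x)" if "x \<in> Omega_A" for x
    using that by (simp add: square_summable_def power_mult_distrib Omega_A_def multinom_pos less_imp_le mult.commute)
  have eq: "norm (sqrt (multinom \<alpha>) *\<^sub>R mu_pow \<alpha> x) * norm (sqrt (multinom \<alpha>) *\<^sub>R mu_pow \<alpha> y) =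
      multinom \<alpha> * (norm (mu_pow \<alpha> x) * norm (mu_pow \<alpha> y))" for \<alpha>
    using multinom_pos[of \<alpha>] by (simp add: mult_ac)
  show ?thesis
    using norm_mult_summable_on[OF *[OF assms(1)] *[OF assms(2)]] unfolding eq .
qed

lemma coord_kernel_vec:
  assumes "x \<in> Omega_A"
  shows "coord (kernel_vec A x \<xi>) = kernel_coord A x \<xi>"
proof -
  define C where "C j = (\<Sum>i\<in>UNIV. norm (A $ i $ j) * norm (\<xi> $ i))" for j
  have "(\<lambda>\<alpha>. (norm (kernel_coord A x \<xi> (j, \<alpha>)))\<^sup>2) summable_on UNIV" for j
  proof (rule summable_on_comparison_test)
    show "(\<lambda>\<alpha>. (C j)\<^sup>2 * (multinom \<alpha> * (norm (mu_pow \<alpha> x) * norm (mu_pow \<alpha> x)))) summable_on UNIV"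
      by (intro summable_on_cmult_right mu_pow_mult_summable assms)
    fix \<alpha>
    have "norm ((ctranspose (scal_mat (mu_pow \<alpha> x) A) *v \<xi>) $ j) \<le> norm (mu_pow \<alpha> x) * C j"
      unfolding ctranspose_scal_mat_vector C_def sum_distrib_left
      by (rule sum_norm_le) (simp add: norm_mult)
    then have "(norm ((ctranspose (scal_mat (mu_pow \<alpha> x) A) *v \<xi>) $ j))\<^sup>2 \<le> (norm (mu_pow \<alpha> x) * C j)\<^sup>2"
      by (rule power_mono) simp
    then have "multinom \<alpha> * (norm ((ctranspose (scal_mat (mu_pow \<alpha> x) A) *v \<xi>) $ j))\<^sup>2 \<le>
        multinom \<alpha> * (norm (mu_pow \<alpha> x) * C j)\<^sup>2"
      using multinom_pos[of \<alpha>] by (intro mult_left_mono) auto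
    then show "(norm (kernel_coord A x \<xi> (j, \<alpha>)))\<^sup>2 \<le>
        (C j)\<^sup>2 * (multinom \<alpha> * (norm (mu_pow \<alpha> x) * norm (mu_pow \<alpha> x)))"
      using multinom_pos[of \<alpha>]
      by (simp add: kernel_coord_def power_mult_distrib) (simp add: power2_eq_square mult_ac)
  qed simp
  then have "((\<lambda>p. (norm (kernel_coord A x \<xi> p))\<^sup>2) has_sum
      (\<Sum>j\<in>UNIV. \<Sum>\<^sub>\<infinity>\<alpha>. (norm (kernel_coord A x \<xi> (j, \<alpha>)))\<^sup>2)) UNIV"
    by (intro has_sum_finite_prod has_sum_infsum)
  then have "square_summable (kernel_coord A x \<xi>)"
    by (auto simp: square_summable_def intro: has_sum_imp_summable)
  then show ?thesis
    by (simp add: kernel_vec_def Abs_ell2_inverse)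
qed

lemma scaleR_kernel_vec:
  assumes "x \<in> Omega_A"
  shows "r *\<^sub>R kernel_vec A x \<xi> = kernel_vec A x (r *\<^sub>R \<xi>)"
  by (rule ell2_eqI)
    (simp add: coord_kernel_vec[OF assms] kernel_coord_def case_prod_unfold ctranspose_scal_mat_vector scaleR_sum_right mult.commute)

lemma inner_kernel_vec:
  fixes u :: "('m::finite \<times> midx, quat) ell2"
  assumes x: "x \<in> Omega_A"
  shows "inner u (kernel_vec A x \<xi>) =
    (\<Sum>i\<in>UNIV. inner (\<Sum>j\<in>UNIV. \<Sum>\<^sub>\<infinity>\<alpha>. mu_pow \<alpha> x * (A $ i $ j * ell2_coeff u j \<alpha>)) (\<xi> $ i))"
proof -
  have "((\<lambda>\<alpha>. mu_pow \<alpha> x * (A $ i $ j * ell2_coeff u j \<alpha>)) has_sum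
      (\<Sum>\<^sub>\<infinity>\<alpha>. mu_pow \<alpha> x * (A $ i $ j * ell2_coeff u j \<alpha>))) UNIV" for i j
  proof (rule has_sum_infsum, rule abs_summable_summable)
    show "(\<lambda>\<alpha>. norm (mu_pow \<alpha> x * (A $ i $ j * ell2_coeff u j \<alpha>))) summable_on UNIV"
      using summable_on_cmult_right[OF mu_pow_mult_abs_summable[OF x weighted_summable_ell2_coeff[of u j]], of "norm (A $ i $ j)"]
      by (simp add: norm_mult mult_ac)
  qed
  then have "((\<lambda>\<alpha>. \<Sum>i\<in>UNIV. inner (mu_pow \<alpha> x * (A $ i $ j * ell2_coeff u j \<alpha>)) (\<xi> $ i)) has_sum
      (\<Sum>i\<in>UNIV. inner (\<Sum>\<^sub>\<infinity>\<alpha>. mu_pow \<alpha> x * (A $ i $ j * ell2_coeff u j \<alpha>)) (\<xi> $ i))) UNIV" for j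
    by (intro has_sum_sum has_sum_bounded_linear[OF bounded_linear_inner_left]) auto
  moreover have "(\<Sum>i\<in>UNIV. inner (mu_pow \<alpha> x * (A $ i $ j * ell2_coeff u j \<alpha>)) (\<xi> $ i)) =
      inner (coord u (j, \<alpha>)) (coord (kernel_vec A x \<xi>) (j, \<alpha>))" for j \<alpha>
    by (simp add: coord_kernel_vec[OF x] kernel_coord_def ctranspose_scal_mat_vector ell2_coeff_def
        inner_sum_right sum_distrib_left inner_mult_qcnj mult.assoc)
  ultimately have "((\<lambda>p. inner (coord u p) (coord (kernel_vec A x \<xi>) p)) has_sum
      (\<Sum>j\<in>UNIV. \<Sum>i\<in>UNIV. inner (\<Sum>\<^sub>\<infinity>\<alpha>. mu_pow \<alpha> x * (A $ i $ j * ell2_coeff u j \<alpha>)) (\<xi> $ i))) UNIV"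
    by (intro has_sum_finite_prod) simp
  then have "inner u (kernel_vec A x \<xi>) =
      (\<Sum>j\<in>UNIV. \<Sum>i\<in>UNIV. inner (\<Sum>\<^sub>\<infinity>\<alpha>. mu_pow \<alpha> x * (A $ i $ j * ell2_coeff u j \<alpha>)) (\<xi> $ i))"
    using inner_ell2_has_sum has_sum_unique by blast
  also have "\<dots> = (\<Sum>i\<in>UNIV. \<Sum>j\<in>UNIV. inner (\<Sum>\<^sub>\<infinity>\<alpha>. mu_pow \<alpha> x * (A $ i $ j * ell2_coeff u j \<alpha>)) (\<xi> $ i))"
    by (rule sum.swap)
  finally show ?thesis
    by (simp add: inner_sum_left)
qed

lemma inner_kernel_vec_mat_1:
  fixes u :: "('n::finite \<times> midx, quat) ell2"
  assumes x: "x \<in> Omega_A"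
  shows "inner u (kernel_vec (mat 1) x \<xi>) =
    (\<Sum>i\<in>UNIV. inner (\<Sum>\<^sub>\<infinity>\<alpha>. mu_pow \<alpha> x * ell2_coeff u i \<alpha>) (\<xi> $ i))"
proof -
  have "(\<Sum>\<^sub>\<infinity>\<alpha>. mu_pow \<alpha> x * (mat 1 $ i $ j * ell2_coeff u j \<alpha>)) =
      (if i = j then \<Sum>\<^sub>\<infinity>\<alpha>. mu_pow \<alpha> x * ell2_coeff u i \<alpha> else 0)" for i j
    by (simp add: mat_def)
  then show ?thesis
    by (simp add: inner_kernel_vec[OF x])
qed

lemma summable_on_vecI:
  fixes f :: "'k \<Rightarrow> 'a::euclidean_space ^ 'n"
  assumes "\<And>i. (\<lambda>k. f k $ i) summable_on A"
  shows "f summable_on A"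
proof -
  have "bounded_linear (axis i :: 'a \<Rightarrow> 'a ^ 'n)" for i
    by (rule linear_conv_bounded_linear[THEN iffD1], rule linearI) (simp_all add: axis_def vec_eq_iff)
  then have "((\<lambda>k. \<Sum>i\<in>UNIV. axis i (f k $ i)) has_sum (\<Sum>i\<in>UNIV. axis i (\<Sum>\<^sub>\<infinity>k\<in>A. f k $ i))) A"
    by (intro has_sum_sum has_sum_bounded_linear[where h="axis i" for i] has_sum_infsum assms) auto
  moreover have "(\<Sum>i\<in>UNIV. axis i (f k $ i)) = f k" for k
    by (simp add: vec_eq_iff axis_def)
  ultimately show ?thesis
    by (auto intro: has_sum_imp_summable)
qed

definition kernel_term :: "quat ^ 'm ^ 'n \<Rightarrow> quat ^ 'm ^ 'n \<Rightarrow> quat \<Rightarrow> quat \<Rightarrow> midx \<Rightarrow> quat ^ 'n ^ 'n" where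
  "kernel_term A B x y \<alpha> = multinom \<alpha> *\<^sub>R (mat (mu_pow \<alpha> x * qcnj (mu_pow \<alpha> y)) -
     scal_mat (mu_pow \<alpha> x) A ** ctranspose (scal_mat (mu_pow \<alpha> y) B))"

lemma kernel_term_summable:
  assumes "x \<in> Omega_A" "y \<in> Omega_A"
  shows "kernel_term A B x y summable_on UNIV"
proof (intro summable_on_vecI)
  fix i j
  define Q where "Q = mat 1 $ i $ j - (\<Sum>k\<in>UNIV. A $ i $ k * qcnj (B $ j $ k))"
  have eq: "kernel_term A B x y \<alpha> $ i $ j = multinom \<alpha> *\<^sub>R (mu_pow \<alpha> x * Q * qcnj (mu_pow \<alpha> y))" for \<alpha>
    by (simp add: kernel_term_def scal_mat_mult_ctranspose Q_def right_diff_distrib left_diff_distrib)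
      (simp add: mat_def)
  show "(\<lambda>\<alpha>. kernel_term A B x y \<alpha> $ i $ j) summable_on UNIV"
  proof (rule abs_summable_summable)
    show "(\<lambda>\<alpha>. norm (kernel_term A B x y \<alpha> $ i $ j)) summable_on UNIV"
      using summable_on_cmult_right[OF mu_pow_mult_summable[OF assms], of "norm Q"]
      by (simp add: eq norm_mult multinom_pos less_imp_le mult_ac)
  qed
qed

lemma sum_kernel_form_eq:
  fixes A :: "nat \<Rightarrow> quat ^ 'm ^ 'n"
  assumes x: "\<And>p. p < N \<Longrightarrow> x p \<in> Omega_A"
  shows "(\<Sum>p<N. \<Sum>q<N. sesq_form (\<xi> p) (\<Sum>\<^sub>\<infinity>\<alpha>. kernel_term (A p) (A q) (x p) (x q) \<alpha>) (\<xi> q)) =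
    of_real ((norm (\<Sum>p<N. kernel_vec (mat 1) (x p) (\<xi> p)))\<^sup>2 - (norm (\<Sum>p<N. kernel_vec (A p) (x p) (\<xi> p)))\<^sup>2)"
proof -
  have gram: "(\<Sum>p<N. \<Sum>q<N. multinom \<alpha> *\<^sub>R sesq_form (\<xi> p)
        (scal_mat (mu_pow \<alpha> (x p)) (B p) ** ctranspose (scal_mat (mu_pow \<alpha> (x q)) (B q))) (\<xi> q)) =
      of_real (\<Sum>j\<in>UNIV. (norm (coord (\<Sum>p<N. kernel_vec (B p) (x p) (\<xi> p)) (j, \<alpha>)))\<^sup>2)"
    for B :: "nat \<Rightarrow> quat ^ 'l ^ 'n" and \<alpha>
  proof -
    let ?v = "\<lambda>p j. (ctranspose (scal_mat (mu_pow \<alpha> (x p)) (B p)) *v \<xi> p) $ j"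
    have c: "coord (\<Sum>p<N. kernel_vec (B p) (x p) (\<xi> p)) (j, \<alpha>) = sqrt (multinom \<alpha>) *\<^sub>R (\<Sum>p<N. ?v p j)" for j
      using x by (simp add: coord_sum coord_kernel_vec kernel_coord_def scaleR_sum_right)
    have "(\<Sum>p<N. \<Sum>q<N. \<Sum>j\<in>UNIV. multinom \<alpha> *\<^sub>R (qcnj (?v p j) * ?v q j)) =
        (\<Sum>j\<in>UNIV. \<Sum>p<N. \<Sum>q<N. multinom \<alpha> *\<^sub>R (qcnj (?v p j) * ?v q j))"
      by (subst sum.swap[of _ UNIV]) (intro sum.cong refl sum.swap)
    also have "\<dots> = (\<Sum>j\<in>UNIV. multinom \<alpha> *\<^sub>R (qcnj (\<Sum>p<N. ?v p j) * (\<Sum>p<N. ?v p j)))"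
      by (simp add: qcnj_sum sum_product scaleR_sum_right)
    also have "\<dots> = (\<Sum>j\<in>UNIV. of_real ((norm (coord (\<Sum>p<N. kernel_vec (B p) (x p) (\<xi> p)) (j, \<alpha>)))\<^sup>2))"
      unfolding c quat_mult_cnj using multinom_pos[of \<alpha>]
      by (simp add: power_mult_distrib of_real_def)
    finally show ?thesis
      by (simp add: sesq_form_mult_ctranspose scaleR_sum_right)
  qed
  have ell2: "((\<lambda>\<alpha>. \<Sum>j\<in>UNIV. (norm (coord u (j, \<alpha>)))\<^sup>2) has_sum (norm u)\<^sup>2) UNIV"
    for u :: "('l::finite \<times> midx, quat) ell2"
  proof -
    have "((\<lambda>p. (norm (coord u p))\<^sup>2) has_sum (norm u)\<^sup>2) UNIV"
      using square_summable_coord[of u] by (simp add: norm_ell2_eq square_summable_def)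
    then have "((\<lambda>(\<alpha>, j). (norm (coord u (j, \<alpha>)))\<^sup>2) has_sum (norm u)\<^sup>2) (UNIV \<times> UNIV)"
      using has_sum_swap[where f="\<lambda>p. (norm (coord u p))\<^sup>2" and S="(norm u)\<^sup>2" and A=UNIV and B=UNIV]
      by simp
    then show ?thesis
      by (rule has_sum_SigmaD) simp
  qed
  have "((\<lambda>\<alpha>. \<Sum>p<N. \<Sum>q<N. sesq_form (\<xi> p) (kernel_term (A p) (A q) (x p) (x q) \<alpha>) (\<xi> q)) has_sum
      (\<Sum>p<N. \<Sum>q<N. sesq_form (\<xi> p) (\<Sum>\<^sub>\<infinity>\<alpha>. kernel_term (A p) (A q) (x p) (x q) \<alpha>) (\<xi> q))) UNIV"
    using x by (intro has_sum_sum has_sum_bounded_linear[OF bounded_linear_sesq_form] has_sum_infsum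
        kernel_term_summable) auto
  moreover have "(\<Sum>p<N. \<Sum>q<N. sesq_form (\<xi> p) (kernel_term (A p) (A q) (x p) (x q) \<alpha>) (\<xi> q)) =
      of_real ((\<Sum>j\<in>UNIV. (norm (coord (\<Sum>p<N. kernel_vec (mat 1) (x p) (\<xi> p)) (j, \<alpha>)))\<^sup>2) +
        - (\<Sum>j\<in>UNIV. (norm (coord (\<Sum>p<N. kernel_vec (A p) (x p) (\<xi> p)) (j, \<alpha>)))\<^sup>2))" for \<alpha>
  proof -
    note lin = bounded_linear.linear[OF bounded_linear_sesq_form]
    have "sesq_form (\<xi> p) (kernel_term (A p) (A q) (x p) (x q) \<alpha>) (\<xi> q) =
        multinom \<alpha> *\<^sub>R sesq_form (\<xi> p) (scal_mat (mu_pow \<alpha> (x p)) (mat 1) ** ctranspose (scal_mat (mu_pow \<alpha> (x q)) (mat 1))) (\<xi> q) -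
        multinom \<alpha> *\<^sub>R sesq_form (\<xi> p) (scal_mat (mu_pow \<alpha> (x p)) (A p) ** ctranspose (scal_mat (mu_pow \<alpha> (x q)) (A q))) (\<xi> q)" for p q
      unfolding kernel_term_def mat_mult_qcnj linear_scale[OF lin] linear_diff[OF lin] scaleR_diff_right ..
    then show ?thesis
      using gram[of \<alpha> "\<lambda>_. mat 1"] gram[of \<alpha> A] by (simp add: sum_subtractf)
  qed
  moreover have "((\<lambda>\<alpha>. of_real ((\<Sum>j\<in>UNIV. (norm (coord (\<Sum>p<N. kernel_vec (mat 1) (x p) (\<xi> p)) (j, \<alpha>)))\<^sup>2) +
        - (\<Sum>j\<in>UNIV. (norm (coord (\<Sum>p<N. kernel_vec (A p) (x p) (\<xi> p)) (j, \<alpha>)))\<^sup>2)) :: quat) has_sum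
      of_real ((norm (\<Sum>p<N. kernel_vec (mat 1) (x p) (\<xi> p)))\<^sup>2 + - (norm (\<Sum>p<N. kernel_vec (A p) (x p) (\<xi> p)))\<^sup>2)) UNIV"
    by (intro has_sum_of_real has_sum_add has_sum_uminusI ell2)
  ultimately show ?thesis
    using has_sum_unique by fastforce
qed

lemma of_real_nonneg_iff: "(of_real r :: quat) \<in> \<real>\<^sub>\<ge>\<^sub>0 \<longleftrightarrow> 0 \<le> r"
  by (auto simp: nonneg_Reals_def of_real_def)

lemma positive_definite_series_iff:
  fixes S :: "quat \<Rightarrow> quat ^ 'm ^ 'n"
  assumes S: "\<And>i j. Vq_regular_on (\<lambda>x. S x $ i $ j) Omega_A"
  shows "positive_definite_series Omega_A
      (\<lambda>\<alpha> x y. multinom \<alpha> *\<^sub>R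
         (mat (mu_pow \<alpha> x * qcnj (mu_pow \<alpha> y)) -
          CK_scalmat Omega_A (mu_pow \<alpha>) S x ** ctranspose (CK_scalmat Omega_A (mu_pow \<alpha>) S y))) \<longleftrightarrow>
    (\<forall>N x \<xi>. (\<forall>p<N. x p \<in> Omega_A) \<longrightarrow>
      norm (\<Sum>p<(N::nat). kernel_vec (S (x p)) (x p) (\<xi> p)) \<le> norm (\<Sum>p<N. kernel_vec (mat 1) (x p) (\<xi> p)))"
    (is "positive_definite_series _ ?k \<longleftrightarrow> _")
proof -
  have k: "(\<lambda>\<alpha>. ?k \<alpha> x y) = kernel_term (S x) (S y) x y" if "x \<in> Omega_A" "y \<in> Omega_A" for x y
    using that by (simp add: fun_eq_iff CK_scalmat_mu_pow[OF S] kernel_term_def scal_mat_def)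
  have "(\<Sum>p<N. \<Sum>q<N. sesq_form (\<xi> p) (\<Sum>\<^sub>\<infinity>\<alpha>. ?k \<alpha> (x p) (x q)) (\<xi> q)) \<in> \<real>\<^sub>\<ge>\<^sub>0 \<longleftrightarrow>
      norm (\<Sum>p<(N::nat). kernel_vec (S (x p)) (x p) (\<xi> p)) \<le> norm (\<Sum>p<N. kernel_vec (mat 1) (x p) (\<xi> p))"
    if x: "\<forall>p<N. x p \<in> Omega_A" for N x \<xi>
  proof -
    have "(\<Sum>p<N. \<Sum>q<N. sesq_form (\<xi> p) (\<Sum>\<^sub>\<infinity>\<alpha>. ?k \<alpha> (x p) (x q)) (\<xi> q)) =
        (\<Sum>p<N. \<Sum>q<N. sesq_form (\<xi> p) (\<Sum>\<^sub>\<infinity>\<alpha>. kernel_term (S (x p)) (S (x q)) (x p) (x q) \<alpha>) (\<xi> q))"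
      by (intro sum.cong refl) (use k x in simp)
    also have "\<dots> = of_real ((norm (\<Sum>p<N. kernel_vec (mat 1) (x p) (\<xi> p)))\<^sup>2 -
        (norm (\<Sum>p<N. kernel_vec (S (x p)) (x p) (\<xi> p)))\<^sup>2)"
      using x by (intro sum_kernel_form_eq) auto
    finally show ?thesis
      by (simp only: of_real_nonneg_iff diff_ge_0_iff_ge abs_le_square_iff[symmetric] abs_norm_cancel)
  qed
  moreover have "(\<lambda>\<alpha>. ?k \<alpha> x y) summable_on UNIV" if "x \<in> Omega_A" "y \<in> Omega_A" for x y
    unfolding k[OF that] by (rule kernel_term_summable[OF that])
  ultimately show ?thesis
    by (simp add: positive_definite_series_def positive_definite_kernel_def)
qed

section \<open>The multiplier theorem\<close>

lemma span_kernel_pairs: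
  fixes S :: "quat \<Rightarrow> quat ^ 'm ^ 'n"
  assumes "w \<in> span {(kernel_vec (mat 1) x \<xi>, kernel_vec (S x) x \<xi>) | x \<xi>. x \<in> Omega_A}"
  obtains N x \<xi> where "\<forall>p<N. x p \<in> Omega_A"
    "w = (\<Sum>p<(N::nat). (kernel_vec (mat 1) (x p) (\<xi> p), kernel_vec (S (x p)) (x p) (\<xi> p)))"
proof -
  from assms have "\<exists>N x \<xi>. (\<forall>p<N. x p \<in> Omega_A) \<and>
      w = (\<Sum>p<(N::nat). (kernel_vec (mat 1) (x p) (\<xi> p), kernel_vec (S (x p)) (x p) (\<xi> p)))"
  proof (induction rule: span_induct_alt)
    case base
    show ?case by (intro exI[of _ 0]) simp
  next
    case (step r b w)
    then obtain N x \<xi> y \<eta> where x: "\<forall>p<N. x p \<in> Omega_A" and y: "y \<in> Omega_A"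
      and w: "w = (\<Sum>p<(N::nat). (kernel_vec (mat 1) (x p) (\<xi> p), kernel_vec (S (x p)) (x p) (\<xi> p)))"
      and b: "b = (kernel_vec (mat 1) y \<eta>, kernel_vec (S y) y \<eta>)"
      by blast
    let ?x = "x(N := y)" and ?\<xi> = "\<xi>(N := r *\<^sub>R \<eta>)"
    have "r *\<^sub>R b + w = (\<Sum>p<Suc N. (kernel_vec (mat 1) (?x p) (?\<xi> p), kernel_vec (S (?x p)) (?x p) (?\<xi> p)))"
      by (simp add: w b scaleR_kernel_vec[OF y] add.commute)
    moreover have "\<forall>p<Suc N. ?x p \<in> Omega_A"
      using x y by (simp add: less_Suc_eq)
    ultimately show ?case by blast
  qed
  then show ?thesis
    using that by blast
qed

lemma CK_matvec_inner:
  fixes S :: "quat \<Rightarrow> quat ^ 'm ^ 'n"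
  assumes S: "\<And>i j. Vq_regular_on (\<lambda>x. S x $ i $ j) Omega_A"
    and f: "\<And>j. mu_series (\<lambda>x. f x $ j) (ell2_coeff u j)" and x: "x \<in> Omega_A"
  shows "(\<Sum>i\<in>UNIV. inner (CK_matvec Omega_A S f x $ i) (\<xi> $ i)) = inner u (kernel_vec (S x) x \<xi>)"
  by (simp add: inner_kernel_vec[OF x] CK_matvec_mu_series[OF S x f weighted_summable_ell2_coeff])

lemma mu_series_inner:
  fixes f :: "quat \<Rightarrow> quat ^ 'n"
  assumes f: "\<And>i. mu_series (\<lambda>x. f x $ i) (ell2_coeff u i)" and x: "x \<in> Omega_A"
  shows "(\<Sum>i\<in>UNIV. inner (f x $ i) (\<xi> $ i)) = inner u (kernel_vec (mat 1) x \<xi>)"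
proof -
  have "(\<Sum>\<^sub>\<infinity>\<alpha>. mu_pow \<alpha> x * ell2_coeff u i \<alpha>) = f x $ i" for i
    using f[of i] x by (intro infsumI) (simp add: mu_series_def)
  then show ?thesis
    by (simp add: inner_kernel_vec_mat_1[OF x])
qed

lemma vec_eq_if_inner_eq:
  fixes v w :: "'a::real_inner ^ 'n"
  assumes "\<And>\<xi>. (\<Sum>i\<in>UNIV. inner (v $ i) (\<xi> $ i)) = (\<Sum>i\<in>UNIV. inner (w $ i) (\<xi> $ i))"
  shows "v = w"
  using assms by (simp add: inner_vec_def[symmetric]) (metis vector_eq_rdot)

theorem theorem6p6:
  fixes S :: "quat \<Rightarrow> quat ^ 'm ^ 'n"
  assumes "\<And>i j. Vq_regular_on (\<lambda>x. S x $ i $ j) Omega_A"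
  shows "contractive_multiplier S \<longleftrightarrow>
    positive_definite_series Omega_A
      (\<lambda>\<alpha> x y. multinom \<alpha> *\<^sub>R
         (mat (mu_pow \<alpha> x * qcnj (mu_pow \<alpha> y)) -
          CK_scalmat Omega_A (mu_pow \<alpha>) S x ** ctranspose (CK_scalmat Omega_A (mu_pow \<alpha>) S y)))"
  unfolding positive_definite_series_iff[OF assms]
proof
  assume S: "contractive_multiplier S"
  show "\<forall>N x \<xi>. (\<forall>p<N. x p \<in> Omega_A) \<longrightarrow>
      norm (\<Sum>p<(N::nat). kernel_vec (S (x p)) (x p) (\<xi> p)) \<le> norm (\<Sum>p<N. kernel_vec (mat 1) (x p) (\<xi> p))"
  proof (intro allI impI)
    fix N :: nat and x and \<xi> :: "nat \<Rightarrow> quat ^ 'n"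
    assume x: "\<forall>p<N. x p \<in> Omega_A"
    define k where "k = (\<Sum>p<N. kernel_vec (mat 1) (x p) (\<xi> p))"
    define b where "b = (\<Sum>p<N. kernel_vec (S (x p)) (x p) (\<xi> p))"
    define f where "f x = (\<chi> j. \<Sum>\<^sub>\<infinity>\<alpha>. mu_pow \<alpha> x * ell2_coeff b j \<alpha>)" for x
    have f: "mu_series (\<lambda>x. f x $ j) (ell2_coeff b j)" for j
      by (simp add: f_def mu_series_infsum weighted_summable_ell2_coeff)
    then have "f \<in> arveson_vec"
      by (auto simp: arveson_vec_iff)
    with S have g: "CK_matvec Omega_A S f \<in> arveson_vec"
      and le: "arveson_vec_norm (CK_matvec Omega_A S f) \<le> arveson_vec_norm f"
      by (auto simp: contractive_multiplier_def)
    obtain g where g: "\<And>i. mu_series (\<lambda>x. CK_matvec Omega_A S f x $ i) (ell2_coeff g i)"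
      using g by (auto simp: arveson_vec_iff)
    have "norm g \<le> norm b"
      using le by (simp add: arveson_vec_norm_eq[OF f] arveson_vec_norm_eq[OF g])
    have "norm b * norm b = inner b b"
      by (simp add: power2_norm_eq_inner[symmetric] power2_eq_square)
    also have "\<dots> = (\<Sum>p<N. inner b (kernel_vec (S (x p)) (x p) (\<xi> p)))"
      by (subst (2) b_def) (rule inner_sum_right)
    also have "\<dots> = (\<Sum>p<N. inner g (kernel_vec (mat 1) (x p) (\<xi> p)))"
      using x by (intro sum.cong refl) (simp add: CK_matvec_inner[OF assms f, symmetric] mu_series_inner[OF g, symmetric])
    also have "\<dots> = inner g k"
      unfolding k_def by (rule inner_sum_right[symmetric])
    also have "\<dots> \<le> norm g * norm k"
      by (rule norm_cauchy_schwarz)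
    also have "\<dots> \<le> norm b * norm k"
      using \<open>norm g \<le> norm b\<close> by (rule mult_right_mono) simp
    finally have "norm b \<le> norm k"
      by (cases "b = 0") (simp_all add: mult_le_cancel_left)
    then show "norm (\<Sum>p<N. kernel_vec (S (x p)) (x p) (\<xi> p)) \<le> norm (\<Sum>p<N. kernel_vec (mat 1) (x p) (\<xi> p))"
      by (simp add: k_def b_def)
  qed
next
  assume pos: "\<forall>N x \<xi>. (\<forall>p<N. x p \<in> Omega_A) \<longrightarrow>
      norm (\<Sum>p<(N::nat). kernel_vec (S (x p)) (x p) (\<xi> p)) \<le> norm (\<Sum>p<N. kernel_vec (mat 1) (x p) (\<xi> p))"
  let ?B = "{(kernel_vec (mat 1) x \<xi>, kernel_vec (S x) x \<xi>) | x \<xi>. x \<in> Omega_A}"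
  have contr: "norm (snd w) \<le> norm (fst w)" if w: "w \<in> span ?B" for w
  proof -
    obtain N x \<xi> where "\<forall>p<N. x p \<in> Omega_A"
      "w = (\<Sum>p<(N::nat). (kernel_vec (mat 1) (x p) (\<xi> p), kernel_vec (S (x p)) (x p) (\<xi> p)))"
      by (rule span_kernel_pairs[OF w])
    then show ?thesis
      using pos by (simp add: fst_sum snd_sum)
  qed
  show "contractive_multiplier S"
    unfolding contractive_multiplier_def
  proof
    fix f :: "quat \<Rightarrow> quat ^ 'm"
    assume "f \<in> arveson_vec"
    then obtain u where u: "\<And>j. mu_series (\<lambda>x. f x $ j) (ell2_coeff u j)"
      by (auto simp: arveson_vec_iff)
    obtain g where g: "norm g \<le> norm u" "\<forall>w\<in>span ?B. inner g (fst w) = inner u (snd w)"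
      by (rule contraction_adjoint[of "span ?B" u, OF subspace_span contr])
    define h where "h x = (\<chi> i. \<Sum>\<^sub>\<infinity>\<alpha>. mu_pow \<alpha> x * ell2_coeff g i \<alpha>)" for x
    have h: "mu_series (\<lambda>x. h x $ i) (ell2_coeff g i)" for i
      by (simp add: h_def mu_series_infsum weighted_summable_ell2_coeff)
    have "CK_matvec Omega_A S f x = h x" if x: "x \<in> Omega_A" for x
    proof (rule vec_eq_if_inner_eq)
      fix \<xi>
      have "(kernel_vec (mat 1) x \<xi>, kernel_vec (S x) x \<xi>) \<in> span ?B"
        using x by (intro span_base) blast
      from bspec[OF g(2) this] show "(\<Sum>i\<in>UNIV. inner (CK_matvec Omega_A S f x $ i) (\<xi> $ i)) = (\<Sum>i\<in>UNIV. inner (h x $ i) (\<xi> $ i))"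
        by (simp add: CK_matvec_inner[OF assms u x] mu_series_inner[OF h x])
    qed
    with h have *: "mu_series (\<lambda>x. CK_matvec Omega_A S f x $ i) (ell2_coeff g i)" for i
      by (simp add: mu_series_def)
    then have "CK_matvec Omega_A S f \<in> arveson_vec"
      by (auto simp: arveson_vec_iff)
    moreover have "arveson_vec_norm (CK_matvec Omega_A S f) \<le> arveson_vec_norm f"
      using g(1) by (simp add: arveson_vec_norm_eq[OF *] arveson_vec_norm_eq[OF u])
    ultimately show "CK_matvec Omega_A S f \<in> arveson_vec \<and>
        arveson_vec_norm (CK_matvec Omega_A S f) \<le> arveson_vec_norm f" ..
  qed
qed

end
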